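(* Let $\mathcal{A}$ be a $C^*$-algebra, let $\mathcal{M}$ and $\mathcal{N}$ be Hilbert $C^*$-modules over $\mathcal{A}$ with $\mathcal{N}$ countably generated, and let $F:\mathcal{M}\to\mathcal{N}$ be an adjointable operator. Let $B$ be the unit ball of $\mathcal{M}$. Then $F$ is $\mathcal{A}$-compact if and only if $F(B)$ is $(\mathcal{N},\mathcal{N})$-totally bounded.
   Context: A (right) Hilbert $C^*$-module $\mathcal{N}$ over $\mathcal{A}$ carries an $\mathcal{A}$-valued inner product $\langle\cdot,\cdot\rangle$ (linear in the second variable, $\langle x,ya\rangle=\langle x,y\rangle a$), and is complete for $\|x\|=\|\langle x,x\rangle\|^{1/2}$; it is countably generated if some countable subset has dense set of $\mathcal{A}$-linear combinations. An operator is a bounded $\mathcal{A}$-linear map; it is adjointable if it has an adjoint w.r.t. the inner products. For $x\in\mathcal{N}$, $y\in\mathcal{M}$, $\theta_{x,y}:\mathcal{M}\to\mathcal{N}$ is $\theta_{x,y}(z)=x\langle y,z\rangle$; an operator is $\mathcal{A}$-compact if it lies in the norm closure of the linear span of all such $\theta_{x,y}$. Admissible systems: for a submodule $\mathcal{N}^0\subset\mathcal{N}$, a countable family $X=\{x_i\}\subset\mathcal{N}$ is $\mathcal{N}^0$-admissible if for each $x\in\mathcal{N}^0$ the partial sums of $\sum_i\langle x,x_i\rangle\langle x_i,x\rangle$ are bounded above by $\langle x,x\rangle$ (in the order of $\mathcal{A}$) and the series converges in norm. For such $X$ and a countable family $\Phi=\{\varphi_1,\varphi_2,\dots\}$ of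 states on $\mathcal{A}$, define for $x,y\in\mathcal{N}^0$ the pseudo-metric $d_{X,\Phi}(x,y)^2=\sup_k\sum_{i=k}^\infty|\varphi_k(\langle x-y,x_i\rangle)|^2$. Total boundedness: a set $Y\subset\mathcal{N}^0\subset\mathcal{N}$ is $(\mathcal{N},\mathcal{N}^0)$-totally bounded if for every $\mathcal{N}^0$-admissible $X\subset\mathcal{N}$, every countable family $\Phi$ of states on $\mathcal{A}$, and every $\varepsilon>0$ there are finitely many $y_1,\dots,y_n\in Y$ such that every $y\in Y$ satisfies $d_{X,\Phi}(y_i,y)<\varepsilon$ for some $i$. *)

theory Defs
  imports "HOL-Analysis.Analysis"
begin

text \<open>
A C*-algebra is modelled as a type 'a of class real_normed_algebra and banach
(a complete normed, associative, possibly non-unital real algebra with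
submultiplicative norm), together with an explicit complex scalar multiplication
cm extending the real one, and an involution st satisfying the C*-identity.
\<close>

definition cstar_algebra ::
  "(complex \<Rightarrow> 'a::{real_normed_algebra,banach} \<Rightarrow> 'a) \<Rightarrow> ('a \<Rightarrow> 'a) \<Rightarrow> bool" where
  "cstar_algebra cm st \<longleftrightarrow>
     (\<forall>r a. cm (complex_of_real r) a = scaleR r a) \<and>
     (\<forall>z w a. cm (z + w) a = cm z a + cm w a) \<and>
     (\<forall>z a b. cm z (a + b) = cm z a + cm z b) \<and>
     (\<forall>z w a. cm z (cm w a) = cm (z * w) a) \<and>
     (\<forall>z a b. cm z (a * b) = cm z a * b \<and> cm z (a * b) = a * cm z b) \<and>
     (\<forall>z a. norm (cm z a) = cmod z * norm a) \<and>
     (\<forall>a. st (st a) = a) \<and>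
     (\<forall>a b. st (a + b) = st a + st b) \<and>
     (\<forall>z a. st (cm z a) = cm (cnj z) (st a)) \<and>
     (\<forall>a b. st (a * b) = st b * st a) \<and>
     (\<forall>a. norm (st a * a) = (norm a)\<^sup>2)"

definition cpos :: "('a::real_normed_algebra \<Rightarrow> 'a) \<Rightarrow> 'a \<Rightarrow> bool" where
  "cpos st a \<longleftrightarrow> (\<exists>b. a = st b * b)"

definition cle :: "('a::real_normed_algebra \<Rightarrow> 'a) \<Rightarrow> 'a \<Rightarrow> 'a \<Rightarrow> bool" where
  "cle st a b \<longleftrightarrow> cpos st (b - a)"

text \<open>
A (right) Hilbert C*-module over the C*-algebra (cm, st): a type 'm of class banach
with complex scalar multiplication mcm, right action ract and A-valued inner
product ip (linear in the second variable), whose norm is the one induced by ip.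
Completeness is given by the banach class.
\<close>

definition hilbert_module ::
  "(complex \<Rightarrow> 'a::{real_normed_algebra,banach} \<Rightarrow> 'a) \<Rightarrow> ('a \<Rightarrow> 'a) \<Rightarrow>
   (complex \<Rightarrow> 'm::banach \<Rightarrow> 'm) \<Rightarrow> ('m \<Rightarrow> 'a \<Rightarrow> 'm) \<Rightarrow> ('m \<Rightarrow> 'm \<Rightarrow> 'a) \<Rightarrow> bool" where
  "hilbert_module cm st mcm ract ip \<longleftrightarrow>
     (\<forall>r x. mcm (complex_of_real r) x = scaleR r x) \<and>
     (\<forall>z w x. mcm (z + w) x = mcm z x + mcm w x) \<and>
     (\<forall>z x y. mcm z (x + y) = mcm z x + mcm z y) \<and>
     (\<forall>z w x. mcm z (mcm w x) = mcm (z * w) x) \<and>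
     (\<forall>x y a. ract (x + y) a = ract x a + ract y a) \<and>
     (\<forall>x a b. ract x (a + b) = ract x a + ract x b) \<and>
     (\<forall>x a b. ract x (a * b) = ract (ract x a) b) \<and>
     (\<forall>z x a. ract (mcm z x) a = mcm z (ract x a) \<and> ract x (cm z a) = mcm z (ract x a)) \<and>
     (\<forall>x y w. ip x (y + w) = ip x y + ip x w) \<and>
     (\<forall>z x y. ip x (mcm z y) = cm z (ip x y)) \<and>
     (\<forall>x y a. ip x (ract y a) = ip x y * a) \<and>
     (\<forall>x y. st (ip x y) = ip y x) \<and>
     (\<forall>x. cpos st (ip x x)) \<and>
     (\<forall>x. ip x x = 0 \<longrightarrow> x = 0) \<and>
     (\<forall>x. norm x = sqrt (norm (ip x x)))"

definition countably_generated :: "('m::banach \<Rightarrow> 'a \<Rightarrow> 'm) \<Rightarrow> bool" where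
  "countably_generated ract \<longleftrightarrow>
     (\<exists>g :: nat \<Rightarrow> 'm.
        closure {(\<Sum>i<n. ract (g i) (c i)) | n c. True} = UNIV)"

definition is_operator ::
  "(complex \<Rightarrow> 'm::banach \<Rightarrow> 'm) \<Rightarrow> ('m \<Rightarrow> 'a \<Rightarrow> 'm) \<Rightarrow>
   (complex \<Rightarrow> 'n::banach \<Rightarrow> 'n) \<Rightarrow> ('n \<Rightarrow> 'a \<Rightarrow> 'n) \<Rightarrow> ('m \<Rightarrow> 'n) \<Rightarrow> bool" where
  "is_operator mcmM ractM mcmN ractN F \<longleftrightarrow>
     (\<forall>x y. F (x + y) = F x + F y) \<and>
     (\<forall>z x. F (mcmM z x) = mcmN z (F x)) \<and>
     (\<forall>x a. F (ractM x a) = ractN (F x) a) \<and>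
     (\<exists>K. \<forall>x. norm (F x) \<le> K * norm x)"

definition adjointable ::
  "('m::banach \<Rightarrow> 'm \<Rightarrow> 'a) \<Rightarrow> ('n::banach \<Rightarrow> 'n \<Rightarrow> 'a) \<Rightarrow> ('m \<Rightarrow> 'n) \<Rightarrow> bool" where
  "adjointable ipM ipN F \<longleftrightarrow> (\<exists>G :: 'n \<Rightarrow> 'm. \<forall>x y. ipN (F x) y = ipM x (G y))"

definition theta :: "('n \<Rightarrow> 'a \<Rightarrow> 'n) \<Rightarrow> ('m \<Rightarrow> 'm \<Rightarrow> 'a) \<Rightarrow> 'n \<Rightarrow> 'm \<Rightarrow> 'm \<Rightarrow> 'n" where
  "theta ractN ipM x y z = ractN x (ipM y z)"

definition A_compact ::
  "(complex \<Rightarrow> 'n::banach \<Rightarrow> 'n) \<Rightarrow> ('n \<Rightarrow> 'a \<Rightarrow> 'n) \<Rightarrow> ('m::banach \<Rightarrow> 'm \<Rightarrow> 'a) \<Rightarrow>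
   ('m \<Rightarrow> 'n) \<Rightarrow> bool" where
  "A_compact mcmN ractN ipM F \<longleftrightarrow>
     (\<forall>\<epsilon>>0. \<exists>n (c :: nat \<Rightarrow> complex) (x :: nat \<Rightarrow> 'n) (y :: nat \<Rightarrow> 'm).
        \<forall>z. norm (F z - (\<Sum>i<n. mcmN (c i) (theta ractN ipM (x i) (y i) z))) \<le> \<epsilon> * norm z)"

definition is_state ::
  "(complex \<Rightarrow> 'a::{real_normed_algebra,banach} \<Rightarrow> 'a) \<Rightarrow> ('a \<Rightarrow> 'a) \<Rightarrow> ('a \<Rightarrow> complex) \<Rightarrow> bool" where
  "is_state cm st \<phi> \<longleftrightarrow>
     (\<forall>a b. \<phi> (a + b) = \<phi> a + \<phi> b) \<and>
     (\<forall>z a. \<phi> (cm z a) = z * \<phi> a) \<and>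
     (\<forall>a. cpos st a \<longrightarrow> \<phi> a \<in> \<real> \<and> Re (\<phi> a) \<ge> 0) \<and>
     (\<forall>a. cmod (\<phi> a) \<le> norm a) \<and>
     (\<forall>\<epsilon>>0. \<exists>a. norm a \<le> 1 \<and> cmod (\<phi> a) > 1 - \<epsilon>)"

definition admissible ::
  "('a::{real_normed_algebra,banach} \<Rightarrow> 'a) \<Rightarrow> ('n \<Rightarrow> 'n \<Rightarrow> 'a) \<Rightarrow> 'n set \<Rightarrow> (nat \<Rightarrow> 'n) \<Rightarrow> bool" where
  "admissible st ip N0 X \<longleftrightarrow>
     (\<forall>x\<in>N0. (\<forall>n. cle st (\<Sum>i<n. ip x (X i) * ip (X i) x) (ip x x)) \<and>
             summable (\<lambda>i. ip x (X i) * ip (X i) x))"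

definition dXPhi_sq ::
  "('n::banach \<Rightarrow> 'n \<Rightarrow> 'a) \<Rightarrow> (nat \<Rightarrow> 'n) \<Rightarrow> (nat \<Rightarrow> 'a \<Rightarrow> complex) \<Rightarrow> 'n \<Rightarrow> 'n \<Rightarrow> ennreal" where
  "dXPhi_sq ip X \<Phi> x y =
     (SUP k. (\<Sum>j. ennreal ((cmod (\<Phi> k (ip (x - y) (X (k + j)))))\<^sup>2)))"

definition totally_bounded_mod ::
  "(complex \<Rightarrow> 'a::{real_normed_algebra,banach} \<Rightarrow> 'a) \<Rightarrow> ('a \<Rightarrow> 'a) \<Rightarrow>
   ('n::banach \<Rightarrow> 'n \<Rightarrow> 'a) \<Rightarrow> 'n set \<Rightarrow> 'n set \<Rightarrow> bool" where
  "totally_bounded_mod cm st ip N0 Y \<longleftrightarrow> Y \<subseteq> N0 \<and>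
     (\<forall>X \<Phi> \<epsilon>. admissible st ip N0 X \<longrightarrow> (\<forall>k. is_state cm st (\<Phi> k)) \<longrightarrow> \<epsilon> > (0::real) \<longrightarrow>
        (\<exists>S. finite S \<and> S \<subseteq> Y \<and>
             (\<forall>y\<in>Y. \<exists>s\<in>S. dXPhi_sq ip X \<Phi> s y < ennreal (\<epsilon>\<^sup>2))))"

end

theory Submission
  imports Defs
begin

text \<open>
Forward direction: for a functional \<open>\<phi>\<close> of norm at most one, \<open>\<Sum>|\<phi>(c\<^sub>i)|\<^sup>2 \<le> \<parallel>\<Sum>c\<^sub>i c\<^sub>i\<^sup>*\<parallel>\<close>. Hence, if \<open>F\<close> is
compact, the tails \<open>\<Sum>\<^sub>i\<^sub>\<ge>\<^sub>n |\<phi>(\<langle>F z, x\<^sub>i\<rangle>)|\<^sup>2\<close> are small uniformly in the unit vector \<open>z\<close> and the state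
\<open>\<phi>\<close>, and only finitely many bounded scalar functions of \<open>z\<close> remain to be approximated.

Backward direction: a countably generated module has a Parseval frame, i.e. vectors \<open>x\<^sub>i\<close> with
\<open>\<Sum>\<langle>x, x\<^sub>i\<rangle>\<langle>x\<^sub>i, x\<rangle> = \<langle>x, x\<rangle>\<close>. It is constructed directly, without the stabilization theorem: starting from
\<open>Q = 1\<close>, subtract \<open>\<theta>\<^sub>v\<^sub>,\<^sub>v\<close> from the positive operator \<open>Q\<close> so that it remains positive and \<open>\<parallel>\<langle>g, Q g\<rangle>\<parallel>\<close> is
halved for a generator \<open>g\<close>, and let \<open>g\<close> run through all generators infinitely often. If \<open>F\<close> were not the
norm limit of its frame truncations, blocks of the frame would yield an admissible system and states
for which \<open>F(B)\<close> is not totally bounded.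

The algebra need not have a unit, so elements \<open>\<alpha> + b\<close> of the unitization are represented by pairs
\<open>(\<alpha>, b)\<close> acting on the algebra by left multiplication.
\<close>

section \<open>Order in a C*-algebra\<close>

locale cstar_alg =
  fixes cm :: "complex \<Rightarrow> 'a::{real_normed_algebra,banach} \<Rightarrow> 'a"
    and st :: "'a \<Rightarrow> 'a"
  assumes cstar: "cstar_algebra cm st"
begin

section \<open>The C*-axioms as rewrite rules, and isometry of the involution\<close>

lemma cm_of_real: "cm (complex_of_real r) a = r *\<^sub>R a"
  and cm_add_left: "cm (z + w) a = cm z a + cm w a"
  and cm_add_right: "cm z (a + b) = cm z a + cm z b"
  and cm_cm: "cm z (cm w a) = cm (z * w) a"
  and cm_mult_left: "cm z a * b = cm z (a * b)"
  and cm_mult_right: "a * cm z b = cm z (a * b)"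
  and norm_cm: "norm (cm z a) = cmod z * norm a"
  and st_st [simp]: "st (st a) = a"
  and st_add: "st (a + b) = st a + st b"
  and st_cm: "st (cm z a) = cm (cnj z) (st a)"
  and st_mult: "st (a * b) = st b * st a"
  and norm_st_mult: "norm (st a * a) = (norm a)\<^sup>2"
  using cstar unfolding cstar_algebra_def by metis+

lemma cm_one [simp]: "cm 1 a = a"
  using cm_of_real[of 1 a] by simp

lemma cm_minus_one [simp]: "cm (-1) a = - a"
  using cm_of_real[of "-1" a] by simp

lemma cm_zero_right [simp]: "cm z 0 = 0"
  using cm_add_right[of z 0 0] by simp

lemma cm_minus_right: "cm z (- a) = - cm z a"
  using cm_add_right[of z a "- a"] by (simp add: eq_neg_iff_add_eq_0 add.commute)

lemma cm_diff_right: "cm z (a - b) = cm z a - cm z b"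
  using cm_add_right[of z a "- b"] by (simp add: cm_minus_right)

lemma cm_sum_right: "cm z (sum f I) = (\<Sum>i\<in>I. cm z (f i))"
  by (induction I rule: infinite_finite_induct) (auto simp: cm_add_right)

lemma cm_ii_ii: "cm \<i> (cm \<i> a) = - a"
  by (simp add: cm_cm)

lemma st_zero [simp]: "st 0 = 0"
  using st_add[of 0 0] by simp

lemma st_minus: "st (- a) = - st a"
  using st_add[of a "- a"] by (simp add: eq_neg_iff_add_eq_0 add.commute)

lemma st_diff: "st (a - b) = st a - st b"
  using st_add[of a "- b"] by (simp add: st_minus)

lemma st_scaleR: "st (r *\<^sub>R a) = r *\<^sub>R st a"
  using st_cm[of "complex_of_real r" a] by (simp add: cm_of_real)

lemma st_sum: "st (sum f I) = (\<Sum>i\<in>I. st (f i))"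
  by (induction I rule: infinite_finite_induct) (auto simp: st_add)

lemma norm_le_norm_st: "norm a \<le> norm (st a)"
proof (cases "a = 0")
  case False
  have "norm a * norm a \<le> norm (st a) * norm a"
    using norm_st_mult[of a] norm_mult_ineq[of "st a" a] by (simp add: power2_eq_square)
  with False show ?thesis by simp
qed simp

lemma norm_st [simp]: "norm (st a) = norm a"
  using norm_le_norm_st[of a] norm_le_norm_st[of "st a"] by simp

lemma norm_mult_st: "norm (a * st a) = (norm a)\<^sup>2"
  using norm_st_mult[of "st a"] by simp

lemma norm_square_selfadjoint: "st h = h \<Longrightarrow> norm (h * h) = (norm h)\<^sup>2"
  using norm_st_mult[of h] by simp

lemma bounded_linear_st: "bounded_linear st"
  by (rule bounded_linear_intro[where K = 1]) (auto simp: st_add st_scaleR)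

lemmas tendsto_st = bounded_linear.tendsto[OF bounded_linear_st]

text \<open>The choice \<open>x = st a\<close> shows that left multiplication by \<open>a\<close>
  has operator norm \<open>norm a\<close>. Estimates in the unitization, made for multiplication
  operators, thereby return to the norm of the algebra.\<close>

lemma norm_le_multiplier:
  fixes a :: 'a
  assumes "\<And>x. norm (a * x) \<le> K * norm x" and "0 \<le> K"
  shows "norm a \<le> K"
proof (cases "a = 0")
  case False
  have "norm a * norm a \<le> K * norm a"
    using assms(1)[of "st a"] norm_mult_st[of a] by (simp add: power2_eq_square)
  with False show ?thesis by simp
qed (use assms in simp)

section \<open>Square roots in the unitization by iteration\<close>

text \<open>
The iteration \<open>k \<mapsto> (G + k\<^sup>2) / 2\<close> with \<open>G = \<gamma> + g\<close> in the unitization and \<open>k = c + a\<close>;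
its limit \<open>k\<close> satisfies \<open>(1 - k)\<^sup>2 = 1 - G\<close>. Norms are estimated by the same iteration for the
scalar 1, which increases to 1, so that \<open>\<parallel>G\<parallel> \<le> 1\<close> suffices for norm convergence.
\<close>

lemma unitized_sqrt_series:
  fixes \<gamma> :: real
  assumes "0 \<le> \<gamma>" "\<gamma> \<le> 1" and G: "\<And>x. norm (\<gamma> *\<^sub>R x + g * x) \<le> norm x" and sg: "st g = g"
  obtains c a where "0 \<le> c" "c \<le> 1" "2 * c = \<gamma> + c\<^sup>2"
    "2 *\<^sub>R a = g + (2 * c) *\<^sub>R a + a * a" "st a = a"
    "\<And>d. d * g = g * d \<Longrightarrow> d * a = a * d"
    "\<And>x. norm (c *\<^sub>R x + a * x) \<le> norm x"
proof -
  define r :: "nat \<Rightarrow> real" where "r = rec_nat 0 (\<lambda>_ r. (1 + r\<^sup>2) / 2)"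
  define c :: "nat \<Rightarrow> real" where "c = rec_nat 0 (\<lambda>_ c. (\<gamma> + c\<^sup>2) / 2)"
  define a where "a = rec_nat 0 (\<lambda>n a. (1/2) *\<^sub>R (g + (2 * c n) *\<^sub>R a + a * a))"
  \<comment> \<open>Left multiplication by the iterate \<open>c n + a n\<close>; all norms are taken
    of this operator.\<close>
  define K where "K n x = c n *\<^sub>R x + a n * x" for n x
  have r0: "r 0 = 0" and rS: "r (Suc n) = (1 + (r n)\<^sup>2) / 2" for n by (simp_all add: r_def)
  have c0: "c 0 = 0" and cS: "c (Suc n) = (\<gamma> + (c n)\<^sup>2) / 2" for n by (simp_all add: c_def)
  have a0: "a 0 = 0" and aS: "a (Suc n) = (1/2) *\<^sub>R (g + (2 * c n) *\<^sub>R a n + a n * a n)" for n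
    by (simp_all add: a_def)
  have KS: "K (Suc n) x = (1/2) *\<^sub>R ((\<gamma> *\<^sub>R x + g * x) + K n (K n x))" for n x
  proof -
    have "(2 * c n) *\<^sub>R a n = c n *\<^sub>R a n + c n *\<^sub>R a n"
      by (simp flip: scaleR_add_left)
    then have "2 *\<^sub>R K (Suc n) x = (\<gamma> *\<^sub>R x + g * x) + K n (K n x)"
      unfolding K_def by (simp add: cS aS algebra_simps power2_eq_square add_divide_distrib)
    then show ?thesis by (metis divide_self_if scaleR_one scaleR_scaleR times_divide_eq_left mult_1 zero_neq_numeral)
  qed
  have Kdiff: "K n (x - y) = K n x - K n y" for n x y
    by (simp add: K_def algebra_simps)
  have r_bd: "0 \<le> r n \<and> r n \<le> 1" for n
  proof (induction n)
    case (Suc n)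
    then have "(r n)\<^sup>2 \<le> 1" by (simp add: power_le_one)
    then show ?case by (simp add: rS add_nonneg_nonneg)
  qed (simp add: r0)
  have r_inc: "r n \<le> r (Suc n)" for n
    using sum_power2_ge_zero[of "r n - 1" 0] by (simp add: rS power2_eq_square algebra_simps)
  have c_bd: "0 \<le> c n \<and> c n \<le> r n" for n
  proof (induction n)
    case (Suc n)
    then have "(c n)\<^sup>2 \<le> (r n)\<^sup>2" by (simp add: power_mono)
    then show ?case using assms by (simp add: rS cS)
  qed (simp add: r0 c0)
  have c_step: "0 \<le> c (Suc n) - c n \<and> c (Suc n) - c n \<le> r (Suc n) - r n" for n
  proof (induction n)
    case 0
    show ?case using assms by (simp add: rS cS r0 c0)
  next
    case (Suc n)
    have e: "c (Suc (Suc n)) - c (Suc n) = (c (Suc n) - c n) * (c (Suc n) + c n) / 2"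
      "r (Suc (Suc n)) - r (Suc n) = (r (Suc n) - r n) * (r (Suc n) + r n) / 2"
      by (simp_all add: cS[of "Suc n"] cS[of n] rS[of "Suc n"] rS[of n] field_simps power2_eq_square)
    have "(c (Suc n) - c n) * (c (Suc n) + c n) \<le> (r (Suc n) - r n) * (r (Suc n) + r n)"
      using Suc c_bd[of n] c_bd[of "Suc n"] by (intro mult_mono) auto
    then show ?case using Suc c_bd[of n] c_bd[of "Suc n"] unfolding e by auto
  qed
  have K_bd: "norm (K n x) \<le> r n * norm x" for n x
  proof (induction n arbitrary: x)
    case (Suc n)
    have "norm (K n (K n x)) \<le> r n * (r n * norm x)"
      using Suc[of "K n x"] Suc[of x] r_bd[of n] by (meson mult_left_mono order_trans)
    then have "norm (K (Suc n) x) \<le> (1/2) * (norm x + r n * (r n * norm x))"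
      unfolding KS using norm_triangle_mono[OF G[of x]] by fastforce
    then show ?case by (simp add: rS power2_eq_square algebra_simps)
  qed (simp add: K_def r0 c0 a0)
  have K_step: "norm (K (Suc n) x - K n x) \<le> (r (Suc n) - r n) * norm x" for n x
  proof (induction n arbitrary: x)
    case 0
    have "K 0 x = 0" by (simp add: K_def c0 a0)
    then show ?case using K_bd[of "Suc 0" x] by (simp add: r0)
  next
    case (Suc n)
    have "K (Suc (Suc n)) x - K (Suc n) x
        = (1/2) *\<^sub>R (K (Suc n) (K (Suc n) x) - K n (K n x))"
      unfolding KS[of "Suc n"] KS[of n] by (simp add: algebra_simps)
    also have "K (Suc n) (K (Suc n) x) - K n (K n x)
        = K (Suc n) (K (Suc n) x - K n x) + (K (Suc n) (K n x) - K n (K n x))"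
      by (simp add: Kdiff)
    finally have "norm (K (Suc (Suc n)) x - K (Suc n) x)
        \<le> (1/2) * (norm (K (Suc n) (K (Suc n) x - K n x)) + norm (K (Suc n) (K n x) - K n (K n x)))"
      by (simp add: norm_triangle_ineq)
    moreover have "norm (K (Suc n) (K (Suc n) x - K n x)) \<le> r (Suc n) * ((r (Suc n) - r n) * norm x)"
      using K_bd[of "Suc n" "K (Suc n) x - K n x"] Suc[of x] r_bd[of "Suc n"]
      by (meson mult_left_mono order_trans)
    moreover have "norm (K (Suc n) (K n x) - K n (K n x)) \<le> (r (Suc n) - r n) * (r n * norm x)"
      using Suc[of "K n x"] K_bd[of n x] r_inc[of n]
      by (meson diff_ge_0_iff_ge mult_left_mono order_trans)
    ultimately have "norm (K (Suc (Suc n)) x - K (Suc n) x)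
        \<le> (1/2) * (r (Suc n) * ((r (Suc n) - r n) * norm x) + (r (Suc n) - r n) * (r n * norm x))"
      by (elim order_trans) (intro mult_left_mono add_mono, auto)
    also have "\<dots> = (r (Suc (Suc n)) - r (Suc n)) * norm x"
      by (simp add: rS[of "Suc n"] rS[of n] field_simps power2_eq_square)
    finally show ?case .
  qed
  \<comment> \<open>Since \<open>a n * x\<close> is \<open>K n x\<close> minus \<open>c n\<close>
    times \<open>x\<close>, an increment of \<open>a\<close> costs one increment of \<open>r\<close>
    for \<open>K\<close> and one for \<open>c\<close>. The increments of \<open>r\<close> telescope,
    so \<open>a\<close> converges absolutely.\<close>
  have a_step: "norm (a (Suc n) - a n) \<le> 2 * (r (Suc n) - r n)" for n
  proof (rule norm_le_multiplier)
    fix x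
    have "(a (Suc n) - a n) * x = (K (Suc n) x - K n x) - (c (Suc n) - c n) *\<^sub>R x"
      by (simp add: K_def algebra_simps)
    then have "norm ((a (Suc n) - a n) * x) \<le> norm (K (Suc n) x - K n x) + (c (Suc n) - c n) * norm x"
      using norm_triangle_ineq4[of "K (Suc n) x - K n x" "(c (Suc n) - c n) *\<^sub>R x"] c_step[of n] by simp
    moreover have "(c (Suc n) - c n) * norm x \<le> (r (Suc n) - r n) * norm x"
      using c_step[of n] by (intro mult_right_mono) auto
    ultimately show "norm ((a (Suc n) - a n) * x) \<le> 2 * (r (Suc n) - r n) * norm x"
      using K_step[of n x] unfolding mult.assoc by linarith
  qed (use r_inc[of n] in simp)
  obtain rl where rl: "r \<longlonglongrightarrow> rl"
    using incseq_convergent[OF incseq_SucI[of r, OF r_inc]] r_bd by metis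
  have "c n \<le> c (Suc n)" "c n \<le> 1" for n
    using c_step[of n] c_bd[of n] r_bd[of n] by auto
  then obtain cl where cl: "c \<longlonglongrightarrow> cl"
    using incseq_convergent[OF incseq_SucI[of c]] by metis
  have "summable (\<lambda>n. 2 * (r (Suc n) - r n))"
    using telescope_summable[OF rl] by (intro summable_mult)
  then have "summable (\<lambda>n. a (Suc n) - a n)"
    using a_step by (rule summable_comparison_test'[where N = 0])
  then have "convergent (\<lambda>n. \<Sum>i<n. a (Suc i) - a i)"
    by (simp add: summable_iff_convergent)
  then obtain al where al: "a \<longlonglongrightarrow> al"
    by (auto simp: sum_lessThan_telescope a0 convergent_def)
  show thesis
  proof
    show "0 \<le> cl" using cl c_bd by (intro LIMSEQ_le_const) auto
    show "cl \<le> 1" using cl c_bd r_bd by (intro LIMSEQ_le_const2) (auto intro: order_trans)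
    have "(\<lambda>n. c (Suc n)) \<longlonglongrightarrow> (\<gamma> + cl\<^sup>2) / 2"
      unfolding cS by (intro tendsto_intros cl) simp
    from LIMSEQ_unique[OF LIMSEQ_Suc[OF cl] this] show "2 * cl = \<gamma> + cl\<^sup>2" by simp
    have "(\<lambda>n. a (Suc n)) \<longlonglongrightarrow> (1/2) *\<^sub>R (g + (2 * cl) *\<^sub>R al + al * al)"
      unfolding aS by (intro tendsto_intros cl al)
    from LIMSEQ_unique[OF LIMSEQ_Suc[OF al] this]
    have e: "al = (1/2) *\<^sub>R (g + (2 * cl) *\<^sub>R al + al * al)" .
    show "2 *\<^sub>R al = g + (2 * cl) *\<^sub>R al + al * al"
      using arg_cong[OF e, of "\<lambda>v. 2 *\<^sub>R v"] by simp
    have "st (a n) = a n" for n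
      by (induction n) (simp_all add: a0 aS st_add st_scaleR st_mult sg)
    then have "a \<longlonglongrightarrow> st al" using tendsto_st[OF al] by simp
    then show "st al = al" using al by (rule LIMSEQ_unique)
    show "d * al = al * d" if d: "d * g = g * d" for d
    proof -
      have "d * a n = a n * d" for n
      proof (induction n)
        case (Suc n)
        have "d * (a n * a n) = a n * a n * d" by (metis Suc mult.assoc)
        then show ?case by (simp add: aS distrib_left distrib_right d Suc)
      qed (simp add: a0)
      moreover have "(\<lambda>n. d * a n) \<longlonglongrightarrow> d * al" "(\<lambda>n. a n * d) \<longlonglongrightarrow> al * d"
        by (intro tendsto_intros al)+
      ultimately show ?thesis by (metis (no_types, lifting) LIMSEQ_unique ext)
    qed
    show "norm (cl *\<^sub>R x + al * x) \<le> norm x" for x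
    proof (rule LIMSEQ_le_const2)
      show "(\<lambda>n. norm (K n x)) \<longlonglongrightarrow> norm (cl *\<^sub>R x + al * x)"
        unfolding K_def by (intro tendsto_intros cl al)
      show "\<exists>N. \<forall>n\<ge>N. norm (K n x) \<le> norm x"
        using K_bd r_bd by (meson mult_left_le_one_le norm_ge_zero order_trans)
    qed
  qed
qed

section \<open>Positive elements of the unitization\<close>

text \<open>\<open>upos \<alpha> b\<close> says that \<open>\<alpha> + b\<close> is a positive element of the unitization, through the norm
criterion \<open>\<parallel>s - (\<alpha> + b)\<parallel> \<le> s\<close> for left multiplication operators.\<close>

definition upos :: "real \<Rightarrow> 'a \<Rightarrow> bool" where
  "upos \<alpha> b \<longleftrightarrow> st b = b \<and> (\<exists>s\<ge>0. \<forall>x. norm ((s - \<alpha>) *\<^sub>R x - b * x) \<le> s * norm x)"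

lemma upos_selfadjoint: "upos \<alpha> b \<Longrightarrow> st b = b"
  by (simp add: upos_def)

text \<open>The witness \<open>s\<close> of positivity may be enlarged: the excess
  \<open>s' - s\<close> is a non-negative multiple of the identity and costs at most its own
  norm.\<close>

lemma upos_bound_mono:
  assumes "\<And>x. norm ((s - \<alpha>) *\<^sub>R x - b * x) \<le> s * norm x" "s \<le> s'"
  shows "norm ((s' - \<alpha>) *\<^sub>R x - b * x) \<le> s' * norm x"
proof -
  have "(s' - \<alpha>) *\<^sub>R x - b * x = ((s - \<alpha>) *\<^sub>R x - b * x) + (s' - s) *\<^sub>R x"
    by (simp add: algebra_simps)
  also have "norm \<dots> \<le> s * norm x + (s' - s) * norm x"
    using assms by (intro norm_triangle_mono) auto
  finally show ?thesis by (simp add: algebra_simps)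
qed

text \<open>This is what the norm criterion is chosen for: the triangle inequality handles sums,
  with the witnesses added, whereas additivity is not evident for elements given as
  \<open>st b * b\<close>.\<close>

lemma upos_add:
  assumes "upos \<alpha> b" "upos \<beta> c"
  shows "upos (\<alpha> + \<beta>) (b + c)"
proof -
  obtain s t where s: "0 \<le> s" "\<And>x. norm ((s - \<alpha>) *\<^sub>R x - b * x) \<le> s * norm x"
    and t: "0 \<le> t" "\<And>x. norm ((t - \<beta>) *\<^sub>R x - c * x) \<le> t * norm x"
    using assms unfolding upos_def by blast
  have "norm ((s + t - (\<alpha> + \<beta>)) *\<^sub>R x - (b + c) * x) \<le> (s + t) * norm x" for x
  proof -
    have "(s + t - (\<alpha> + \<beta>)) *\<^sub>R x - (b + c) * x
        = ((s - \<alpha>) *\<^sub>R x - b * x) + ((t - \<beta>) *\<^sub>R x - c * x)"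
      by (simp add: algebra_simps)
    also have "norm \<dots> \<le> s * norm x + t * norm x"
      using norm_triangle_mono[OF s(2) t(2)] .
    finally show ?thesis by (simp add: algebra_simps)
  qed
  moreover have "st (b + c) = b + c" "0 \<le> s + t"
    using assms s t by (auto simp: upos_def st_add)
  ultimately show ?thesis unfolding upos_def by blast
qed

lemma upos_scaleR:
  assumes "upos \<alpha> b" "0 \<le> r"
  shows "upos (r * \<alpha>) (r *\<^sub>R b)"
proof -
  obtain s where s: "0 \<le> s" "\<And>x. norm ((s - \<alpha>) *\<^sub>R x - b * x) \<le> s * norm x"
    using assms unfolding upos_def by blast
  have "norm ((r * s - r * \<alpha>) *\<^sub>R x - (r *\<^sub>R b) * x) \<le> r * s * norm x" for x
  proof -
    have "(r * s - r * \<alpha>) *\<^sub>R x - (r *\<^sub>R b) * x = r *\<^sub>R ((s - \<alpha>) *\<^sub>R x - b * x)"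
      by (simp add: algebra_simps)
    then show ?thesis using mult_left_mono[OF s(2)[of x] assms(2)] assms(2) by simp
  qed
  moreover have "st (r *\<^sub>R b) = r *\<^sub>R b" "0 \<le> r * s"
    using assms s by (auto simp: upos_def st_scaleR)
  ultimately show ?thesis unfolding upos_def by blast
qed

lemma upos_of_norm_le:
  assumes "st b = b" "norm b \<le> \<alpha>"
  shows "upos \<alpha> b"
  unfolding upos_def
proof (intro conjI exI allI)
  show "norm ((\<alpha> - \<alpha>) *\<^sub>R x - b * x) \<le> \<alpha> * norm x" for x
    using norm_mult_ineq[of b x] assms(2) by (simp add: mult_right_mono order_trans)
  show "0 \<le> \<alpha>" using assms(2) norm_ge_zero order_trans by blast
qed fact

text \<open>Since \<open>1 - (\<alpha> + b) / s\<close> has norm at most 1, the iteration gives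
  \<open>c + a\<close> with \<open>(1 - (c + a))^2 = (\<alpha> + b) / s\<close>, and the root is
  \<open>sqrt s\<close> times \<open>1 - (c + a)\<close>. The two equations obtained are the scalar
  part and the algebra part of \<open>(\<sigma> + e)^2 = \<alpha> + b\<close>.\<close>

lemma upos_sqrt:
  assumes "upos \<alpha> b" "0 \<le> \<alpha>"
  obtains \<sigma> e where "0 \<le> \<sigma>" "\<sigma>\<^sup>2 = \<alpha>" "(2 * \<sigma>) *\<^sub>R e + e * e = b" "upos \<sigma> e"
    "\<And>d. d * b = b * d \<Longrightarrow> d * e = e * d"
proof -
  obtain s0 where s0: "\<And>x. norm ((s0 - \<alpha>) *\<^sub>R x - b * x) \<le> s0 * norm x"
    using assms unfolding upos_def by blast
  \<comment> \<open>Enlarged so that \<open>s\<close> is positive and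
    \<open>1 - \<alpha> / s\<close> lies between 0 and 1, as the iteration requires.\<close>
  define s where "s = max s0 (\<alpha> + 1)"
  have s: "0 < s" "\<alpha> \<le> s" using assms(2) by (auto simp: s_def)
  have sb: "norm ((s - \<alpha>) *\<^sub>R x - b * x) \<le> s * norm x" for x
    by (rule upos_bound_mono[OF s0]) (simp add: s_def)
  have 1: "norm ((1 - \<alpha> / s) *\<^sub>R x + (-(1/s) *\<^sub>R b) * x) \<le> norm x" for x
  proof -
    have "(1 - \<alpha> / s) *\<^sub>R x + (-(1/s) *\<^sub>R b) * x = (1/s) *\<^sub>R ((s - \<alpha>) *\<^sub>R x - b * x)"
      using s by (simp add: algebra_simps)
    also have "norm \<dots> \<le> (1/s) * (s * norm x)"
      using mult_left_mono[OF sb[of x], of "1/s"] s by simp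
    finally show ?thesis using s by simp
  qed
  have 2: "0 \<le> 1 - \<alpha> / s" "1 - \<alpha> / s \<le> 1" using s assms(2) by auto
  have 3: "st (-(1/s) *\<^sub>R b) = -(1/s) *\<^sub>R b"
    using assms by (simp add: upos_def st_scaleR st_minus)
  obtain c a where ca: "0 \<le> c" "c \<le> 1" "2 * c = (1 - \<alpha> / s) + c\<^sup>2"
    "2 *\<^sub>R a = -(1/s) *\<^sub>R b + (2 * c) *\<^sub>R a + a * a" "st a = a"
    "\<And>d. d * (-(1/s) *\<^sub>R b) = (-(1/s) *\<^sub>R b) * d \<Longrightarrow> d * a = a * d"
    "\<And>x. norm (c *\<^sub>R x + a * x) \<le> norm x"
    by (rule unitized_sqrt_series[OF 2 1 3]) (rule that)
  define \<sigma> where "\<sigma> = sqrt s * (1 - c)"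
  define e where "e = - sqrt s *\<^sub>R a"
  show thesis
  proof
    show "0 \<le> \<sigma>" using s ca(1,2) by (simp add: \<sigma>_def)
    have "\<sigma>\<^sup>2 = s * (1 - 2 * c + c\<^sup>2)"
      using s by (simp add: \<sigma>_def power_mult_distrib) (simp add: power2_eq_square algebra_simps)
    also have "\<dots> = \<alpha>" using s by (subst ca(3)) (simp add: field_simps)
    finally show "\<sigma>\<^sup>2 = \<alpha>" .
    have ss: "sqrt s * (sqrt s * u) = s * u" for u
      using s by (simp flip: mult.assoc)
    have "(2 * \<sigma>) *\<^sub>R e + e * e = s *\<^sub>R ((2 * c) *\<^sub>R a + a * a - 2 *\<^sub>R a)"
      using s by (simp add: \<sigma>_def e_def algebra_simps ss)
    also have "\<dots> = b" using s by (subst ca(4)) (simp add: algebra_simps)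
    finally show "(2 * \<sigma>) *\<^sub>R e + e * e = b" .
    have "norm ((sqrt s - \<sigma>) *\<^sub>R x - e * x) \<le> sqrt s * norm x" for x
    proof -
      have "(sqrt s - \<sigma>) *\<^sub>R x - e * x = sqrt s *\<^sub>R (c *\<^sub>R x + a * x)"
        by (simp add: \<sigma>_def e_def algebra_simps)
      then show ?thesis using ca(7)[of x] s by simp
    qed
    then show "upos \<sigma> e" unfolding upos_def using s ca(5)
      by (auto simp: e_def st_scaleR st_minus intro!: exI[of _ "sqrt s"])
    show "d * e = e * d" if "d * b = b * d" for d
      using ca(6)[of d] that by (simp add: e_def)
  qed
qed

text \<open>The element \<open>u = h + i k\<close> with commuting selfadjoint \<open>h = \<sigma> + e\<close>, \<open>k = \<tau> + f\<close> satisfies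
\<open>u\<^sup>* u = u u\<^sup>* = t\<close>, and \<open>h = (u + u\<^sup>*) / 2\<close>.\<close>

lemma norm_le_of_squares_sum:
  assumes "st e = e" "st f = f" "e * f = f * e" "\<sigma>\<^sup>2 + \<tau>\<^sup>2 = t"
    and sq: "(2 * \<sigma>) *\<^sub>R e + e * e + ((2 * \<tau>) *\<^sub>R f + f * f) = 0"
  shows "norm (\<sigma> *\<^sub>R x + e * x) \<le> sqrt t * norm x"
proof -
  define y where "y = \<sigma> *\<^sub>R x + e * x"
  define w where "w = \<tau> *\<^sub>R x + f * x"
  have sy: "st y = \<sigma> *\<^sub>R st x + st x * e" and sw: "st w = \<tau> *\<^sub>R st x + st x * f"
    using assms by (simp_all add: y_def w_def st_add st_scaleR st_mult)
  have efx: "e * (f * x) = f * (e * x)" by (metis assms(3) mult.assoc)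
  have yw: "st y * w = st w * y"
    unfolding sy sw unfolding y_def w_def by (simp add: algebra_simps efx)
  have "st y * y + st w * w
      = (\<sigma>\<^sup>2 + \<tau>\<^sup>2) *\<^sub>R (st x * x) + st x * ((2 * \<sigma>) *\<^sub>R e + e * e + ((2 * \<tau>) *\<^sub>R f + f * f)) * x"
    unfolding sy sw unfolding y_def w_def
    by (simp add: algebra_simps power2_eq_square scaleR_2 flip: scaleR_scaleR)
  then have yy: "st y * y + st w * w = t *\<^sub>R (st x * x)" using sq assms(4) by simp
  \<comment> \<open>Covers \<open>z = \<i>\<close> and \<open>z = -\<i>\<close> at once, that is,
    the operators \<open>h + z k\<close> applied to \<open>x\<close>; the mixed terms of
    \<open>st u * u\<close> cancel by \<open>yw\<close>.\<close>
  have "norm u = sqrt t * norm x" if "u = y + cm z w" "z * z = -1" "cnj z = - z" for u z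
  proof -
    have mz: "cm (- z) v = - cm z v" for v
      using cm_cm[of "-1" z v] by simp
    have "st u * u = st y * y + cm z (st y * w) - cm z (st w * y) - cm (z * z) (st w * w)"
      by (simp add: that st_add st_cm mz distrib_left distrib_right cm_mult_left cm_mult_right cm_cm
          cm_add_right cm_diff_right cm_minus_right algebra_simps)
    also have "\<dots> = t *\<^sub>R (st x * x)"
      using yy yw by (simp add: that(2))
    finally have "(norm u)\<^sup>2 = \<bar>t\<bar> * (norm x)\<^sup>2"
      using norm_st_mult[of u] norm_st_mult[of x] by simp
    moreover have "t \<ge> 0" using assms(4) by (metis sum_power2_ge_zero)
    ultimately show ?thesis
      by (metis abs_of_nonneg norm_ge_zero real_sqrt_abs real_sqrt_mult)
  qed
  from this[of _ \<i>] this[of _ "-\<i>"]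
  have "norm (y + cm \<i> w) = sqrt t * norm x" "norm (y + cm (-\<i>) w) = sqrt t * norm x"
    by auto
  moreover have "(y + cm \<i> w) + (y + cm (-\<i>) w) = 2 *\<^sub>R y"
    using cm_add_left[of \<i> "-\<i>" w] cm_of_real[of 0 w] by (simp add: scaleR_2)
  ultimately have "2 * norm y \<le> sqrt t * norm x + sqrt t * norm x"
    by (metis norm_triangle_ineq norm_scaleR abs_numeral)
  then show ?thesis by (simp add: y_def)
qed

text \<open>The scaled square \<open>(\<sigma> + e)^2 / t\<close> has norm at most 1, so the
  iteration yields a root \<open>\<tau> + f\<close> of \<open>t - (\<sigma> + e)^2\<close> that
  commutes with \<open>e\<close>. The two squares add up to \<open>t\<close>, which bounds
  \<open>\<tau> + f\<close> by \<open>sqrt t\<close> and its square by \<open>t\<close>.\<close>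

lemma unitized_square_bound:
  assumes se: "st e = e" and "0 < t" and bd: "\<And>x. norm (\<sigma> *\<^sub>R x + e * x) \<le> sqrt t * norm x"
    and "\<sigma>\<^sup>2 \<le> t"
  shows "norm ((t - \<sigma>\<^sup>2) *\<^sub>R x - ((2 * \<sigma>) *\<^sub>R e + e * e) * x) \<le> t * norm x"
proof -
  define b where "b = (2 * \<sigma>) *\<^sub>R e + e * e"
  have dbl: "(2 * \<sigma>) *\<^sub>R e = \<sigma> *\<^sub>R e + \<sigma> *\<^sub>R e" by (simp flip: scaleR_add_left)
  have 1: "norm ((\<sigma>\<^sup>2 / t) *\<^sub>R x + ((1/t) *\<^sub>R b) * x) \<le> norm x" for x
  proof -
    have "(\<sigma>\<^sup>2 / t) *\<^sub>R x + ((1/t) *\<^sub>R b) * x = (1/t) *\<^sub>R (\<sigma> *\<^sub>R (\<sigma> *\<^sub>R x + e * x) + e * (\<sigma> *\<^sub>R x + e * x))"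
      unfolding b_def dbl by (simp add: algebra_simps power2_eq_square)
    also have "norm \<dots> \<le> (1/t) * (sqrt t * (sqrt t * norm x))"
      using order_trans[OF bd[of "\<sigma> *\<^sub>R x + e * x"] mult_left_mono[OF bd[of x], of "sqrt t"]] \<open>0 < t\<close>
      by (simp add: divide_right_mono)
    also have "\<dots> = norm x" using \<open>0 < t\<close> by (simp flip: mult.assoc)
    finally show ?thesis .
  qed
  have 2: "0 \<le> \<sigma>\<^sup>2 / t" "\<sigma>\<^sup>2 / t \<le> 1" using assms by auto
  have 3: "st ((1/t) *\<^sub>R b) = (1/t) *\<^sub>R b"
    by (simp add: b_def st_scaleR st_add st_mult se)
  obtain c a where ca: "0 \<le> c" "c \<le> 1" "2 * c = \<sigma>\<^sup>2 / t + c\<^sup>2"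
    "2 *\<^sub>R a = (1/t) *\<^sub>R b + (2 * c) *\<^sub>R a + a * a" "st a = a"
    "\<And>d. d * ((1/t) *\<^sub>R b) = ((1/t) *\<^sub>R b) * d \<Longrightarrow> d * a = a * d"
    by (rule unitized_sqrt_series[OF 2 1 3]) (rule that)
  define \<tau> where "\<tau> = sqrt t * (1 - c)"
  define f where "f = - sqrt t *\<^sub>R a"
  have tt: "sqrt t * (sqrt t * u) = t * u" for u
    using \<open>0 < t\<close> by (simp flip: mult.assoc)
  have "\<tau>\<^sup>2 = t * (1 - 2 * c + c\<^sup>2)"
    using \<open>0 < t\<close> by (simp add: \<tau>_def power_mult_distrib) (simp add: power2_eq_square algebra_simps)
  also have "\<dots> = t - \<sigma>\<^sup>2" using \<open>0 < t\<close> by (subst ca(3)) (simp add: field_simps)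
  finally have tau: "\<tau>\<^sup>2 = t - \<sigma>\<^sup>2" .
  have "(2 * \<tau>) *\<^sub>R f + f * f = t *\<^sub>R ((2 * c) *\<^sub>R a + a * a - 2 *\<^sub>R a)"
    using \<open>0 < t\<close> by (simp add: \<tau>_def f_def algebra_simps tt)
  also have "\<dots> = - b" using \<open>0 < t\<close> by (subst ca(4)) (simp add: algebra_simps)
  finally have f: "(2 * \<tau>) *\<^sub>R f + f * f = - b" .
  have "e * b = b * e" by (simp add: b_def algebra_simps)
  then have "e * a = a * e" using ca(6)[of e] by simp
  then have ef: "f * e = e * f" by (simp add: f_def)
  have bd': "norm (\<tau> *\<^sub>R x + f * x) \<le> sqrt t * norm x" for x
    using norm_le_of_squares_sum[of f e \<tau> \<sigma> t x] ef tau f ca(5) se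
    by (simp add: f_def b_def st_scaleR st_minus)
  have dbl': "(2 * \<tau>) *\<^sub>R f = \<tau> *\<^sub>R f + \<tau> *\<^sub>R f" by (simp flip: scaleR_add_left)
  have "(t - \<sigma>\<^sup>2) *\<^sub>R x - b * x = \<tau>\<^sup>2 *\<^sub>R x + ((2 * \<tau>) *\<^sub>R f + f * f) * x"
    by (simp add: tau f)
  also have "\<dots> = \<tau> *\<^sub>R (\<tau> *\<^sub>R x + f * x) + f * (\<tau> *\<^sub>R x + f * x)"
    unfolding dbl' by (simp add: algebra_simps power2_eq_square)
  also have "norm \<dots> \<le> sqrt t * (sqrt t * norm x)"
    using order_trans[OF bd'[of "\<tau> *\<^sub>R x + f * x"] mult_left_mono[OF bd'[of x], of "sqrt t"]] \<open>0 < t\<close>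
    by simp
  also have "\<dots> = t * norm x" by (simp add: tt)
  finally show ?thesis by (simp add: b_def)
qed

text \<open>Any positive \<open>t\<close> whose root dominates the norm of
  \<open>\<sigma> + e\<close> is a witness; the summand 1 in the choice of \<open>t\<close> makes it
  positive.\<close>

lemma upos_square:
  assumes "st e = e"
  shows "upos (\<sigma>\<^sup>2) ((2 * \<sigma>) *\<^sub>R e + e * e)"
proof -
  define t where "t = (\<bar>\<sigma>\<bar> + norm e + 1)\<^sup>2"
  have st: "sqrt t = \<bar>\<sigma>\<bar> + norm e + 1" by (simp add: t_def)
  have 1: "norm (\<sigma> *\<^sub>R x + e * x) \<le> sqrt t * norm x" for x
    using norm_triangle_ineq[of "\<sigma> *\<^sub>R x" "e * x"] norm_mult_ineq[of e x]
    by (simp add: st algebra_simps) (smt (verit) norm_ge_zero)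
  have 2: "0 < t" unfolding t_def by (smt (verit) norm_ge_zero zero_less_power)
  have 3: "\<sigma>\<^sup>2 \<le> t" unfolding t_def by (intro abs_le_square_iff[THEN iffD1]) simp
  show ?thesis
    unfolding upos_def using unitized_square_bound[OF assms 2 1 3] 2
    by (intro conjI exI[of _ t]) (simp_all add: assms st_add st_scaleR st_mult)
qed

lemma upos_selfadjoint_square: "st h = h \<Longrightarrow> upos 0 (h * h)"
  using upos_square[of h 0] by simp

lemma upos_zero_sqrt:
  assumes "upos 0 b"
  obtains e where "e * e = b" "upos 0 e" "\<And>d. d * b = b * d \<Longrightarrow> d * e = e * d"
proof -
  obtain \<sigma> e where e: "\<sigma>\<^sup>2 = 0" "(2 * \<sigma>) *\<^sub>R e + e * e = b" "upos \<sigma> e"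
    and comm: "\<And>d. d * b = b * d \<Longrightarrow> d * e = e * d"
    by (rule upos_sqrt[OF assms order_refl]) (rule that)
  show thesis
  proof
    show "e * e = b" "upos 0 e" using e by auto
  qed (fact comm)
qed

text \<open>Positivity provides only some witness \<open>s\<close>; here \<open>norm p\<close>
  itself becomes one. If \<open>h\<close> is the root of \<open>p\<close>, then
  \<open>norm p\<close> is the square of \<open>norm h\<close>, so the bound for squares applies
  with \<open>\<sigma> = 0\<close> and \<open>t = norm p\<close>.\<close>

lemma upos_bound:
  assumes "upos 0 p"
  shows "norm (norm p *\<^sub>R x - p * x) \<le> norm p * norm x"
proof (cases "p = 0")
  case False
  obtain h where h: "h * h = p" "upos 0 h" using upos_zero_sqrt[OF assms] by metis
  then have sh: "st h = h" by (simp add: upos_def)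
  have np: "norm p = (norm h)\<^sup>2" using h sh norm_square_selfadjoint by blast
  have "norm (h * x) \<le> sqrt (norm p) * norm x" for x
    using norm_mult_ineq[of h x] by (simp add: np)
  with unitized_square_bound[OF sh, of "norm p" 0 x] False h show ?thesis by simp
qed simp

text \<open>Write \<open>p = h^2\<close> and \<open>t - p = (\<tau> + f)^2\<close> with commuting
  roots. The squares add up to \<open>t\<close>, so multiplication by \<open>h\<close> is bounded by
  \<open>sqrt t\<close>.\<close>

lemma norm_le_of_upos:
  assumes "upos 0 p" "upos t (- p)" "0 \<le> t"
  shows "norm p \<le> t"
proof -
  obtain h where h: "h * h = p" "upos 0 h" using upos_zero_sqrt[OF assms(1)] by metis
  then have sh: "st h = h" by (simp add: upos_def)
  obtain \<tau> f where f: "\<tau>\<^sup>2 = t" "(2 * \<tau>) *\<^sub>R f + f * f = - p" "upos \<tau> f"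
    "\<And>d. d * (- p) = (- p) * d \<Longrightarrow> d * f = f * d"
    by (rule upos_sqrt[OF assms(2,3)]) (rule that)
  have "h * f = f * h" using h by (intro f(4)) (auto simp: mult.assoc)
  then have bd: "norm (h * x) \<le> sqrt t * norm x" for x
    using norm_le_of_squares_sum[of h f 0 \<tau> t x] f(1-3) sh h(1) by (simp add: upos_def)
  have "norm h \<le> sqrt t" using assms(3) by (intro norm_le_multiplier[OF bd]) simp
  then have "(norm h)\<^sup>2 \<le> t" using assms(3) by (metis norm_ge_zero power_mono real_sqrt_pow2)
  then show ?thesis using norm_square_selfadjoint[OF sh] h(1) by simp
qed

text \<open>The element \<open>norm q - p\<close> is the sum of the positive elements
  \<open>norm q - q\<close> and \<open>q - p\<close>.\<close>

lemma upos_norm_mono: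
  assumes "upos 0 p" "upos 0 (q - p)"
  shows "norm p \<le> norm q"
proof (rule norm_le_of_upos[OF assms(1)])
  have "st q = q" using upos_add[OF assms] by (simp add: upos_def)
  then have "upos (norm q) (- q)" by (intro upos_of_norm_le) (simp_all add: st_minus)
  from upos_add[OF this assms(2)] show "upos (norm q) (- p)" by simp
qed simp

text \<open>Kaplansky's theorem. With \<open>b = c\<^sup>* c\<close>, \<open>e = |b|\<close>, \<open>m = e - b\<close> and \<open>y = c m\<close> one has
\<open>y\<^sup>* y = - g\<close> with \<open>g = (e\<^sup>1\<^sup>/\<^sup>2 m)\<^sup>2 \<ge> 0\<close>, while \<open>v = y y\<^sup>*\<close> is positive. For \<open>r = \<parallel>y\<parallel>\<^sup>2\<close> this gives
\<open>2 r\<^sup>2 = \<parallel>2 g\<^sup>2\<parallel> \<le> \<parallel>r g + g\<^sup>2\<parallel> = \<parallel>y\<^sup>* (r - v) y\<parallel> \<le> r\<^sup>2\<close>, so \<open>y = 0\<close> and then \<open>m = 0\<close>.\<close>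

lemma upos_st_mult: "upos 0 (st c * c)"
proof -
  define b where "b = st c * c"
  have sb: "st b = b" by (simp add: b_def st_mult)
  obtain e where e: "e * e = b * b" "upos 0 e"
    and ecomm: "\<And>d. d * (b * b) = b * b * d \<Longrightarrow> d * e = e * d"
    by (rule upos_zero_sqrt[OF upos_selfadjoint_square[OF sb]]) (rule that)
  have se: "st e = e" using e by (simp add: upos_def)
  have be: "b * e = e * b" by (rule ecomm) (simp add: mult.assoc)
  obtain q where q: "q * q = e" "upos 0 q"
    and qcomm: "\<And>d. d * e = e * d \<Longrightarrow> d * q = q * d"
    by (rule upos_zero_sqrt[OF e(2)]) (rule that)
  have sq: "st q = q" using q by (simp add: upos_def)
  have bq: "b * q = q * b" using be by (rule qcomm)
  have eq: "e * q = q * e" by (rule qcomm) simp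
  define m where "m = e - b"
  have sm: "st m = m" by (simp add: m_def st_diff sb se)
  have mq: "m * q = q * m" using bq eq by (simp add: m_def algebra_simps)
  have me: "m * e = e * m" using be by (simp add: m_def algebra_simps)
  have mm: "m * m = 2 *\<^sub>R (e * m)"
    using be e(1) by (simp add: m_def algebra_simps scaleR_2)
  have bm: "b * m = - (e * m)"
    using be e(1) by (simp add: m_def algebra_simps)
  define k where "k = q * m"
  have sk: "st k = k" using mq by (simp add: k_def st_mult sq sm)
  define g where "g = k * k"
  have "g = (m * q) * (q * m)" by (simp only: g_def k_def mq)
  also have "\<dots> = m * (q * q) * m" by (simp only: mult.assoc)
  finally have g_eq: "g = m * e * m" by (simp only: q(1))
  define y where "y = c * m"
  have yy: "st y * y = - g"
  proof -
    have "st y * y = m * (b * m)" by (simp add: y_def st_mult sm b_def mult.assoc)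
    then show ?thesis by (simp add: bm g_eq mult.assoc)
  qed
  \<comment> \<open>The squares of the selfadjoint elements \<open>\<i> (y - st y)\<close> and
    \<open>y + st y\<close> add up to \<open>2 (y * st y + st y * y)\<close>. As
    \<open>st y * y = - g\<close>, adding \<open>g = k * k\<close> leaves \<open>y * st y\<close>
    positive.\<close>
  have "cm (- \<i>) x = - cm \<i> x" for x using cm_cm[of "-1" \<i> x] by simp
  then have "st (cm \<i> (y - st y)) = cm \<i> (y - st y)"
    by (simp add: st_cm st_diff cm_diff_right)
  from upos_selfadjoint_square[OF this]
  have "upos 0 (cm \<i> (y - st y) * cm \<i> (y - st y))" .
  moreover have "upos 0 ((y + st y) * (y + st y))"
    by (rule upos_selfadjoint_square) (simp add: st_add add.commute)
  ultimately have "upos (0 + 0) (cm \<i> (y - st y) * cm \<i> (y - st y) + (y + st y) * (y + st y))"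
    by (rule upos_add)
  then
  have "upos 0 (2 *\<^sub>R (y * st y) + 2 *\<^sub>R (st y * y))"
    unfolding cm_mult_left cm_mult_right cm_ii_ii by (simp add: algebra_simps scaleR_2)
  from upos_scaleR[OF this, of "1/2"] have "upos 0 (y * st y + st y * y)"
    by (simp add: scaleR_add_right)
  from upos_add[OF this upos_selfadjoint_square[OF sk]]
  have v: "upos 0 (y * st y)" by (simp add: yy g_def)
  define r where "r = (norm y)\<^sup>2"
  have nv: "norm (y * st y) = r" by (simp add: r_def norm_mult_st)
  have ng: "norm g = r" using norm_st_mult[of y] by (simp add: r_def yy)
  have sg: "st g = g" by (simp add: g_def st_mult sk)
  have "norm (r *\<^sub>R y - y * st y * y) \<le> r * norm y"
    using upos_bound[OF v, of y] by (simp add: nv)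
  then have "norm (st y * (r *\<^sub>R y - y * st y * y)) \<le> norm y * (r * norm y)"
    using norm_mult_ineq[of "st y" "r *\<^sub>R y - y * st y * y"]
    by (simp add: order_trans[OF _ mult_left_mono])
  moreover have "st y * (r *\<^sub>R y - y * st y * y) = r *\<^sub>R (st y * y) - (st y * y) * (st y * y)"
    by (simp add: algebra_simps)
  then have "norm (st y * (r *\<^sub>R y - y * st y * y)) = norm (r *\<^sub>R g + g * g)"
    using norm_minus_cancel[of "r *\<^sub>R g + g * g"] by (simp add: yy)
  ultimately have up: "norm (r *\<^sub>R g + g * g) \<le> r * r"
    by (simp add: r_def power2_eq_square algebra_simps)
  \<comment> \<open>With a root of \<open>r - g\<close> that commutes with \<open>k\<close>, the
    element \<open>r g - g^2\<close> is the square of a selfadjoint element; hence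
    \<open>2 g^2\<close> lies below \<open>r g + g^2\<close>.\<close>
  have "upos r (- g)" using ng by (intro upos_of_norm_le) (simp_all add: st_minus sg)
  moreover have "0 \<le> r" by (simp add: r_def)
  ultimately obtain \<sigma> f where f: "\<sigma>\<^sup>2 = r" "(2 * \<sigma>) *\<^sub>R f + f * f = - g" "upos \<sigma> f"
    and fcomm: "\<And>d. d * (- g) = (- g) * d \<Longrightarrow> d * f = f * d"
    by (rule upos_sqrt) (rule that)
  have fk: "k * f = f * k" by (rule fcomm) (simp add: g_def mult.assoc)
  have sf: "st f = f" using f by (simp add: upos_def)
  have "st (\<sigma> *\<^sub>R k + f * k) = \<sigma> *\<^sub>R k + f * k"
    by (simp add: st_add st_scaleR st_mult sk sf fk)
  from upos_selfadjoint_square[OF this]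
  have "upos 0 ((\<sigma> *\<^sub>R k + f * k) * (\<sigma> *\<^sub>R k + f * k))" .
  moreover have "(\<sigma> *\<^sub>R k + f * k) * (\<sigma> *\<^sub>R k + f * k) = \<sigma>\<^sup>2 *\<^sub>R g + ((2 * \<sigma>) *\<^sub>R f + f * f) * g"
  proof -
    have "k * (f * k) = f * (k * k)" by (metis fk mult.assoc)
    then show ?thesis
      by (simp add: g_def algebra_simps power2_eq_square scaleR_2 flip: scaleR_scaleR)
  qed
  ultimately have "upos 0 (r *\<^sub>R g - g * g)" using f by simp
  moreover have "upos 0 (2 *\<^sub>R (g * g))"
    using upos_scaleR[OF upos_selfadjoint_square[OF sg], of 2] by simp
  ultimately have "norm (2 *\<^sub>R (g * g)) \<le> norm (r *\<^sub>R g + g * g)"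
    by (intro upos_norm_mono) (simp_all add: scaleR_2)
  then have "2 * (r * r) \<le> r * r"
    using up norm_square_selfadjoint[OF sg] ng by (simp add: power2_eq_square)
  then have "r = 0" by (metis add_le_same_cancel2 mult_2 mult_eq_0_iff order_antisym zero_le_square)
  then have "g = 0" using ng by simp
  then have "k = 0" using norm_square_selfadjoint[OF sk] by (simp add: g_def)
  then have "e * m = 0" by (metis k_def q(1) mult.assoc mult_zero_right)
  then have "m = 0" using mm norm_square_selfadjoint[OF sm] by simp
  then have "b = e" by (simp add: m_def)
  then show ?thesis using e(2) b_def by simp
qed

lemma cpos_iff_upos: "cpos st a \<longleftrightarrow> upos 0 a"
proof
  show "upos 0 a" if "cpos st a" using that upos_st_mult by (auto simp: cpos_def)
  assume a: "upos 0 a"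
  obtain e where "e * e = a" "upos 0 e" by (rule upos_zero_sqrt[OF a]) (rule that)
  then show "cpos st a" unfolding cpos_def by (auto simp: upos_def intro!: exI[of _ e])
qed

section \<open>The order defined by positive elements\<close>

lemma cpos_st_mult: "cpos st (st a * a)"
  by (auto simp: cpos_def)

lemma cpos_mult_st: "cpos st (a * st a)"
  using cpos_st_mult[of "st a"] by simp

lemma cpos_selfadjoint: "cpos st a \<Longrightarrow> st a = a"
  by (auto simp: cpos_iff_upos upos_def)

lemma cpos_zero [simp]: "cpos st 0"
  using cpos_st_mult[of 0] by simp

lemma cpos_add: "cpos st a \<Longrightarrow> cpos st b \<Longrightarrow> cpos st (a + b)"
  using upos_add[of 0 a 0 b] by (simp add: cpos_iff_upos)

lemma cpos_scaleR: "cpos st a \<Longrightarrow> 0 \<le> r \<Longrightarrow> cpos st (r *\<^sub>R a)"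
  using upos_scaleR[of 0 a r] by (simp add: cpos_iff_upos)

lemma cpos_sum: "(\<And>i. i \<in> I \<Longrightarrow> cpos st (f i)) \<Longrightarrow> cpos st (sum f I)"
  by (induction I rule: infinite_finite_induct) (auto intro: cpos_add)

lemma cle_trans: "cle st a b \<Longrightarrow> cle st b c \<Longrightarrow> cle st a c"
  using cpos_add[of "b - a" "c - b"] by (simp add: cle_def)

lemma cle_sum_mono: "(\<And>i. i \<in> I \<Longrightarrow> cle st (f i) (g i)) \<Longrightarrow> cle st (sum f I) (sum g I)"
  using cpos_sum[of I "\<lambda>i. g i - f i"] by (simp add: cle_def sum_subtractf)

lemma norm_mono_cle: "cpos st a \<Longrightarrow> cle st a b \<Longrightarrow> norm a \<le> norm b"
  by (simp add: cle_def cpos_iff_upos upos_norm_mono)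

text \<open>Conjugation by \<open>a\<close> carries the positive element \<open>norm p - p\<close>
  of the unitization, written as \<open>(\<sigma> + f)^2\<close>, to \<open>st z * z\<close> with
  \<open>z = \<sigma> a + f a\<close>.\<close>

lemma cle_conj_norm:
  assumes "cpos st p"
  shows "cle st (st a * p * a) (norm p *\<^sub>R (st a * a))"
proof -
  have sp: "st p = p" using assms by (rule cpos_selfadjoint)
  then have "upos (norm p) (- p)" by (intro upos_of_norm_le) (simp_all add: st_minus)
  then obtain \<sigma> f where f: "\<sigma>\<^sup>2 = norm p" "(2 * \<sigma>) *\<^sub>R f + f * f = - p" "upos \<sigma> f"
    by (rule upos_sqrt[OF _ norm_ge_zero]) (rule that)
  have "st (\<sigma> *\<^sub>R a + f * a) * (\<sigma> *\<^sub>R a + f * a)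
      = \<sigma>\<^sup>2 *\<^sub>R (st a * a) + st a * ((2 * \<sigma>) *\<^sub>R f + f * f) * a"
    using upos_selfadjoint[OF f(3)]
    by (simp add: st_add st_scaleR st_mult algebra_simps power2_eq_square scaleR_2 flip: scaleR_scaleR)
  then have "norm p *\<^sub>R (st a * a) - st a * p * a = st (\<sigma> *\<^sub>R a + f * a) * (\<sigma> *\<^sub>R a + f * a)"
    by (simp add: f(1,2))
  then show ?thesis unfolding cle_def using cpos_st_mult by simp
qed

end

section \<open>Existence of states\<close>

definition sublinear :: "('v::real_vector \<Rightarrow> real) \<Rightarrow> bool" where
  "sublinear p \<longleftrightarrow> (\<forall>x y. p (x + y) \<le> p x + p y) \<and> (\<forall>r\<ge>0. \<forall>x. p (r *\<^sub>R x) = r * p x)"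

lemma sublinearI:
  fixes p :: "'v::real_vector \<Rightarrow> real"
  assumes add: "\<And>x y. p (x + y) \<le> p x + p y" and "p 0 = 0"
    and scale: "\<And>r x. 0 < r \<Longrightarrow> p (r *\<^sub>R x) \<le> r * p x"
  shows "sublinear p"
  unfolding sublinear_def
proof (intro conjI allI impI add)
  fix r :: real and x assume "0 \<le> r"
  show "p (r *\<^sub>R x) = r * p x"
  proof (cases "r = 0")
    case False
    with \<open>0 \<le> r\<close> have "0 < r" by simp
    then have "p ((1/r) *\<^sub>R (r *\<^sub>R x)) \<le> (1/r) * p (r *\<^sub>R x)" by (intro scale) simp
    then have "r * p x \<le> p (r *\<^sub>R x)" using \<open>0 < r\<close> by (simp add: field_simps)
    with scale[OF \<open>0 < r\<close>, of x] show ?thesis by simp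
  qed (simp add: assms)
qed

lemma sublinear_zero: "sublinear p \<Longrightarrow> p 0 = 0"
  unfolding sublinear_def by (metis mult_zero_left order_refl scaleR_zero_left)

lemma sublinear_ge: "sublinear p \<Longrightarrow> - p (- x) \<le> p x"
  using sublinear_zero[of p] unfolding sublinear_def by (metis add.right_inverse neg_le_iff_le minus_le_iff real_0_le_add_iff)

text \<open>Serves for the subadditivity of functionals that are defined as infima.\<close>

lemma le_cINF_add:
  fixes f :: "'i \<Rightarrow> real" and g :: "'j \<Rightarrow> real"
  assumes "A \<noteq> {}" "B \<noteq> {}" "\<And>i j. i \<in> A \<Longrightarrow> j \<in> B \<Longrightarrow> L \<le> f i + g j"
  shows "L \<le> (INF i\<in>A. f i) + (INF j\<in>B. g j)"
proof -
  have "L - (INF j\<in>B. g j) \<le> f i" if "i \<in> A" for i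
  proof -
    have "L - f i \<le> (INF j\<in>B. g j)"
      using assms that by (intro cINF_greatest) (auto simp: algebra_simps)
    then show ?thesis by simp
  qed
  then have "L - (INF j\<in>B. g j) \<le> (INF i\<in>A. f i)"
    using assms(1) by (intro cINF_greatest)
  then show ?thesis by simp
qed

text \<open>The Hahn-Banach reduction in direction \<open>a\<close>: \<open>q'\<close> is the
  infimum of \<open>q (x + t a) - t q a\<close> over \<open>t \<ge> 0\<close>, finite because
  \<open>- q (- x)\<close> is a lower bound. The value \<open>t = 0\<close> gives
  \<open>q' \<le> q\<close>, and \<open>t = 1\<close> at \<open>- a\<close> gives the last
  bound.\<close>

lemma sublinear_reduce:
  fixes q :: "'v::real_vector \<Rightarrow> real"
  assumes q: "sublinear q"
  obtains q' where "sublinear q'" "\<And>x. q' x \<le> q x" "q' (- a) \<le> - q a"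
proof -
  have qadd: "q (x + y) \<le> q x + q y" and qscale: "0 \<le> r \<Longrightarrow> q (r *\<^sub>R x) = r * q x" for x y r
    using q by (auto simp: sublinear_def)
  define h where "h x t = q (x + t *\<^sub>R a) - t * q a" for x t
  define q' where "q' x = (INF t\<in>{0..}. h x t)" for x
  have low: "- q (- x) \<le> h x t" if "0 \<le> t" for x t
    using qadd[of "x + t *\<^sub>R a" "- x"] qscale[of t a] that by (simp add: h_def)
  have bdd: "bdd_below (h x ` {0..})" for x
    using low by (intro bdd_belowI2[of _ "- q (- x)"]) auto
  have le: "q' x \<le> h x t" if "0 \<le> t" for x t
    unfolding q'_def using that by (intro cINF_lower bdd) auto
  show thesis
  proof
    show "q' x \<le> q x" for x using le[of 0 x] by (simp add: h_def)
    show "q' (- a) \<le> - q a" using le[of 1 "- a"] by (simp add: h_def sublinear_zero[OF q])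
    show "sublinear q'"
    proof (rule sublinearI)
      show "q' (x + y) \<le> q' x + q' y" for x y
        unfolding q'_def[of x] q'_def[of y]
      proof (rule le_cINF_add)
        fix s t :: real assume "s \<in> {0..}" "t \<in> {0..}"
        then have "q' (x + y) \<le> h (x + y) (s + t)" by (intro le) auto
        also have "\<dots> \<le> h x s + h y t"
          using qadd[of "x + s *\<^sub>R a" "y + t *\<^sub>R a"] by (simp add: h_def algebra_simps)
        finally show "q' (x + y) \<le> h x s + h y t" .
      qed auto
      have "h 0 t = 0" if "0 \<le> t" for t using qscale[OF that, of a] by (simp add: h_def)
      then show "q' 0 = 0" unfolding q'_def by simp
      show "q' (r *\<^sub>R x) \<le> r * q' x" if "0 < r" for r x
      proof -
        have "q' (r *\<^sub>R x) / r \<le> h x t" if "0 \<le> t" for t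
        proof -
          have "q' (r *\<^sub>R x) \<le> h (r *\<^sub>R x) (r * t)" using \<open>0 < r\<close> that by (intro le) simp
          also have "\<dots> = r * h x t"
            using qscale[of r "x + t *\<^sub>R a"] \<open>0 < r\<close> by (simp add: h_def algebra_simps)
          finally show ?thesis using \<open>0 < r\<close> by (simp add: field_simps)
        qed
        then have "q' (r *\<^sub>R x) / r \<le> q' x" unfolding q'_def[of x] by (intro cINF_greatest) auto
        then show ?thesis using \<open>0 < r\<close> by (simp add: field_simps)
      qed
    qed
  qed
qed

text \<open>A minimal sublinear functional is linear.\<close>

lemma exists_linear_below_sublinear:
  fixes p :: "'v::real_vector \<Rightarrow> real"
  assumes p: "sublinear p"
  obtains f where "linear f" "\<And>x. f x \<le> p x"
proof -
  define A where "A = {q. sublinear q \<and> q \<le> p}"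
  \<comment> \<open>Zorn's lemma for the reversed order: maximal means minimal below
    \<open>p\<close>, and the pointwise infimum bounds a chain.\<close>
  have "\<exists>f\<in>A. \<forall>q\<in>A. f \<ge> q \<longrightarrow> q = f"
  proof (rule predicate_Zorn)
    show "partial_order_on A (relation_of (\<ge>) A)"
      by (rule partial_order_on_relation_ofI) auto
    fix C assume "C \<in> Chains (relation_of (\<ge>) A)"
    then have CA: "C \<subseteq> A" and chain: "\<And>q r. q \<in> C \<Longrightarrow> r \<in> C \<Longrightarrow> q \<le> r \<or> r \<le> q"
      by (auto simp: Chains_def relation_of_def)
    show "\<exists>u\<in>A. \<forall>q\<in>C. u \<le> q"
    proof (cases "C = {}")
      case True
      then show ?thesis using p by (auto simp: A_def)
    next
      case False
      define u where "u x = (INF q\<in>C. q x)" for x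
      have "- p (- x) \<le> q x" if "q \<in> C" for q x
      proof -
        have "sublinear q" "q \<le> p" using that CA by (auto simp: A_def)
        then show ?thesis using sublinear_ge[of q x] by (metis le_fun_def neg_le_iff_le order_trans)
      qed
      then have bdd: "bdd_below ((\<lambda>q. q x) ` C)" for x by (rule bdd_belowI2)
      have le: "u x \<le> q x" if "q \<in> C" for q x
        unfolding u_def using that by (intro cINF_lower bdd)
      have "sublinear u"
      proof (rule sublinearI)
        show "u (x + y) \<le> u x + u y" for x y
          unfolding u_def[of x] u_def[of y]
        proof (rule le_cINF_add[OF False False])
          fix q r assume "q \<in> C" "r \<in> C"
          then obtain s where s: "s \<in> C" "s \<le> q" "s \<le> r" using chain by blast
          have "sublinear s" using s CA by (auto simp: A_def)
          then have "u (x + y) \<le> s x + s y"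
            using order_trans[OF le[OF s(1), of "x + y"]] by (simp add: sublinear_def)
          also have "\<dots> \<le> q x + r y" using s by (simp add: le_fun_def add_mono)
          finally show "u (x + y) \<le> q x + r y" .
        qed
        have "q 0 = 0" if "q \<in> C" for q using that CA by (auto simp: A_def intro: sublinear_zero)
        then have "(\<lambda>q. q 0) ` C = {0}" using False by force
        then show "u 0 = 0" by (simp add: u_def)
        show "u (r *\<^sub>R x) \<le> r * u x" if "0 < r" for r x
        proof -
          have "u (r *\<^sub>R x) / r \<le> q x" if "q \<in> C" for q
          proof -
            have "q (r *\<^sub>R x) = r * q x" using that CA \<open>0 < r\<close> by (auto simp: A_def sublinear_def)
            then show ?thesis using le[OF that, of "r *\<^sub>R x"] \<open>0 < r\<close> by (simp add: field_simps)
          qed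
          then have "u (r *\<^sub>R x) / r \<le> u x" unfolding u_def[of x] by (intro cINF_greatest False)
          then show ?thesis using \<open>0 < r\<close> by (simp add: field_simps)
        qed
      qed
      moreover have "u \<le> p"
      proof -
        obtain q where "q \<in> C" using False by blast
        then have "u \<le> q" "q \<le> p" using le CA by (auto simp: A_def le_fun_def)
        then show ?thesis by (rule order_trans)
      qed
      ultimately have "u \<in> A" by (simp add: A_def)
      then show ?thesis using le by (intro bexI[of _ u]) (simp_all add: le_fun_def)
    qed
  qed
  then obtain f where f: "sublinear f" "f \<le> p"
    and min: "\<And>q. sublinear q \<Longrightarrow> q \<le> f \<Longrightarrow> q = f"
    unfolding A_def by (auto intro: order_trans)
  \<comment> \<open>Reduction in direction \<open>a\<close> cannot change a minimal functional, so
    \<open>f (- a) \<le> - f a\<close>; an odd sublinear functional is linear.\<close>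
  have odd: "f (- a) = - f a" for a
  proof -
    obtain q where q: "sublinear q" "\<And>x. q x \<le> f x" "q (- a) \<le> - f a"
      by (rule sublinear_reduce[OF f(1)]) (rule that)
    then have "q = f" by (intro min) (auto simp: le_fun_def)
    with q(3) sublinear_ge[OF f(1), of a] show ?thesis by simp
  qed
  show thesis
  proof
    show "f x \<le> p x" for x using f(2) by (simp add: le_fun_def)
    have sub: "f (x + y) \<le> f x + f y" and scale: "0 \<le> r \<Longrightarrow> f (r *\<^sub>R x) = r * f x" for x y r
      using f(1) by (auto simp: sublinear_def)
    show "linear f"
    proof (rule linearI)
      show "f (x + y) = f x + f y" for x y
        using sub[of x y] sub[of "x + y" "- y"] odd[of y] by simp
      show "f (r *\<^sub>R x) = r *\<^sub>R f x" for r x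
        using scale[of r x] scale[of "- r" x] odd[of "r *\<^sub>R x"] by (cases "0 \<le> r") auto
    qed
  qed
qed

text \<open>Reducing in direction \<open>a\<close> first forces every linear functional below
  \<open>q\<close> to take the value \<open>p a\<close> at \<open>a\<close>.\<close>

lemma hahn_banach_norming:
  fixes p :: "'v::real_vector \<Rightarrow> real"
  assumes "sublinear p"
  obtains f where "linear f" "\<And>x. f x \<le> p x" "f a = p a"
proof -
  obtain q where q: "sublinear q" "\<And>x. q x \<le> p x" "q (- a) \<le> - p a"
    by (rule sublinear_reduce[OF assms]) (rule that)
  obtain f where f: "linear f" "\<And>x. f x \<le> q x"
    by (rule exists_linear_below_sublinear[OF q(1)]) (rule that)
  show thesis
  proof
    show "f x \<le> p x" for x using f(2) q(2) order_trans by blast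
    have "- f a \<le> - p a" using f(2)[of "- a"] q(3) linear_neg[OF f(1), of a] by simp
    then show "f a = p a" using f(2)[of a] q(2)[of a] by simp
  qed fact
qed

section \<open>States that norm a positive element\<close>

context cstar_alg
begin

text \<open>Hahn-Banach for \<open>p b\<close>, the infimum of the \<open>t \<ge> 0\<close> that
  dominate \<open>(b + st b) / 2\<close>. It vanishes at negatives of positive elements and at skew
  elements, which makes \<open>f\<close> non-negative on the former's opposites and zero on the
  latter; at the positive element \<open>a\<close> it equals \<open>norm a\<close>.\<close>

lemma exists_real_positive_functional:
  assumes "cpos st a"
  obtains f where "linear f" "\<And>x. f x \<le> norm x" "\<And>x. cpos st x \<Longrightarrow> 0 \<le> f x"
    "\<And>x. st x = - x \<Longrightarrow> f x = 0" "f a = norm a"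
proof -
  define D where "D b = {t. 0 \<le> t \<and> upos t (- (1/2) *\<^sub>R (b + st b))}" for b
  define p where "p b = Inf (D b)" for b
  have nD: "norm b \<in> D b" for b
  proof -
    have "norm (b + st b) \<le> 2 * norm b" using norm_triangle_ineq[of b "st b"] by simp
    then show ?thesis unfolding D_def
      by (auto intro!: upos_of_norm_le simp: st_minus st_scaleR st_add add.commute)
  qed
  have bdd: "bdd_below (D b)" for b by (rule bdd_belowI[of _ 0]) (auto simp: D_def)
  have ple: "p b \<le> t" if "t \<in> D b" for t b
    unfolding p_def using that bdd by (rule cInf_lower)
  have pge: "L \<le> p b" if "\<And>t. t \<in> D b \<Longrightarrow> L \<le> t" for L b
    unfolding p_def using nD that by (intro cInf_greatest) auto
  have p0: "0 \<le> p b" for b by (rule pge) (simp add: D_def)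
  have "sublinear p"
  proof (rule sublinearI)
    show "p (b + c) \<le> p b + p c" for b c
    proof -
      have "p (b + c) \<le> (INF t\<in>D b. t) + (INF t\<in>D c. t)"
      proof (rule le_cINF_add)
        fix s t assume "s \<in> D b" "t \<in> D c"
        then have "s + t \<in> D (b + c)"
          using upos_add[of s "- (1/2) *\<^sub>R (b + st b)" t "- (1/2) *\<^sub>R (c + st c)"]
          by (simp add: D_def st_add algebra_simps)
        then show "p (b + c) \<le> s + t" by (rule ple)
      qed (use nD in auto)
      then show ?thesis by (simp add: p_def)
    qed
    have "0 \<in> D 0" using nD[of 0] by simp
    then show "p 0 = 0" using ple p0 by (metis order_antisym)
    show "p (r *\<^sub>R b) \<le> r * p b" if r: "0 < r" for r b
    proof -
      have "p (r *\<^sub>R b) / r \<le> t" if "t \<in> D b" for t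
      proof -
        have "r * t \<in> D (r *\<^sub>R b)"
          using upos_scaleR[of t "- (1/2) *\<^sub>R (b + st b)" r] that r
          by (simp add: D_def st_scaleR algebra_simps)
        then show ?thesis using ple r by (simp add: field_simps)
      qed
      then have "p (r *\<^sub>R b) / r \<le> p b" by (rule pge)
      then show ?thesis using r by (simp add: field_simps)
    qed
  qed
  then obtain f where f: "linear f" "\<And>x. f x \<le> p x" "f a = p a"
    by (rule hahn_banach_norming) (rule that)
  have half: "(1/2) *\<^sub>R (x + x) = x" for x :: 'a by (simp flip: scaleR_2)
  show thesis
  proof
    show fn: "f x \<le> norm x" for x using f(2)[of x] ple[OF nD] by (rule order_trans)
    show "0 \<le> f x" if "cpos st x" for x
    proof -
      have "0 \<in> D (- x)"
        using that by (simp add: D_def cpos_selfadjoint cpos_iff_upos[symmetric] st_minus half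
            flip: scaleR_minus_right)
      then have "f (- x) \<le> 0" using f(2)[of "- x"] ple by force
      then show ?thesis using linear_neg[OF f(1)] by simp
    qed
    show "f x = 0" if "st x = - x" for x
    proof -
      have "0 \<in> D x" "0 \<in> D (- x)"
        using that cpos_zero by (auto simp: D_def cpos_iff_upos st_minus)
      then have "f x \<le> 0" "f (- x) \<le> 0" using f(2)[of x] f(2)[of "- x"] ple by force+
      then show ?thesis using linear_neg[OF f(1)] by simp
    qed
    have "norm a \<le> p a"
    proof (rule pge)
      fix t assume "t \<in> D a"
      then have "0 \<le> t" "upos t (- a)"
        using half[of a] by (auto simp: D_def cpos_selfadjoint[OF assms])
      then show "norm a \<le> t" using assms by (intro norm_le_of_upos) (auto simp: cpos_iff_upos)
    qed
    with fn[of a] show "f a = norm a" by (simp add: f(3))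
  qed fact
qed

text \<open>The state is the complexification \<open>f x - \<i> f (\<i> x)\<close>. For positive
  \<open>x\<close> the element \<open>\<i> x\<close> is skew, so the imaginary part
  vanishes.\<close>

lemma exists_norming_state:
  assumes "cpos st a" "a \<noteq> 0"
  obtains \<phi> where "is_state cm st \<phi>" "\<phi> a = complex_of_real (norm a)"
proof -
  obtain f where f: "linear f" "\<And>x. f x \<le> norm x" "\<And>x. cpos st x \<Longrightarrow> 0 \<le> f x"
    "\<And>x. st x = - x \<Longrightarrow> f x = 0" "f a = norm a"
    by (rule exists_real_positive_functional[OF assms(1)]) (rule that)
  define \<phi> where "\<phi> x = Complex (f x) (- f (cm \<i> x))" for x
  have fadd: "f (x + y) = f x + f y" and fscale: "f (r *\<^sub>R x) = r * f x" for x y r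
    using f(1) by (auto simp: linear_add linear_scale)
  have cm_split: "cm z x = Re z *\<^sub>R x + Im z *\<^sub>R cm \<i> x" for z x
  proof -
    have "cm z x = cm (complex_of_real (Re z) + complex_of_real (Im z) * \<i>) x"
      by (metis complex_eq mult.commute)
    then show ?thesis by (simp add: cm_add_left cm_of_real flip: cm_cm)
  qed
  have lin: "\<phi> (x + y) = \<phi> x + \<phi> y" "\<phi> (cm z x) = z * \<phi> x" for x y z
  proof -
    show "\<phi> (x + y) = \<phi> x + \<phi> y" by (simp add: \<phi>_def cm_add_right fadd complex_eq_iff)
    have "cm \<i> (cm z x) = (- Im z) *\<^sub>R x + Re z *\<^sub>R cm \<i> x"
      using cm_split[of "\<i> * z" x] by (simp add: cm_cm)
    then have "f (cm \<i> (cm z x)) = - Im z * f x + Re z * f (cm \<i> x)"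
      by (simp only: fadd fscale)
    moreover have "f (cm z x) = Re z * f x + Im z * f (cm \<i> x)"
      by (simp only: cm_split[of z] fadd fscale)
    ultimately show "\<phi> (cm z x) = z * \<phi> x"
      by (simp add: \<phi>_def complex_eq_iff algebra_simps)
  qed
  have pos: "\<phi> x = complex_of_real (f x)" if "cpos st x" for x
  proof -
    have "cm (- \<i>) x = - cm \<i> x" using cm_cm[of "-1" \<i> x] by simp
    then have "f (cm \<i> x) = 0" by (intro f(4)) (simp add: st_cm cpos_selfadjoint[OF that])
    then show ?thesis by (simp add: \<phi>_def complex_eq_iff)
  qed
  have bound: "cmod (\<phi> x) \<le> norm x" for x
  proof (cases "\<phi> x = 0")
    case False
    \<comment> \<open>The phase that turns \<open>\<phi> x\<close> into its modulus, so that the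
      real bound for \<open>f\<close> yields the complex one.\<close>
    define z where "z = cnj (\<phi> x) / complex_of_real (cmod (\<phi> x))"
    have "\<phi> (cm z x) = complex_of_real (cmod (\<phi> x))"
      using False complex_norm_square[of "\<phi> x"]
      by (simp add: lin(2) z_def field_simps power2_eq_square)
    then have "cmod (\<phi> x) = f (cm z x)" by (metis \<phi>_def Re_complex_of_real complex.sel(1))
    also have "\<dots> \<le> norm (cm z x)" by (rule f(2))
    also have "\<dots> = norm x" using False by (simp add: norm_cm z_def norm_divide)
    finally show ?thesis .
  qed simp
  have phia: "\<phi> a = complex_of_real (norm a)" using pos[OF assms(1)] f(5) by simp
  have "norm ((1 / norm a) *\<^sub>R a) \<le> 1" "\<phi> ((1 / norm a) *\<^sub>R a) = 1"
    using assms(2) lin(2)[of "complex_of_real (1 / norm a)" a] phia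
    unfolding cm_of_real by auto
  then have "\<exists>b. norm b \<le> 1 \<and> 1 - \<epsilon> < cmod (\<phi> b)" if "0 < \<epsilon>" for \<epsilon>
    using that by (intro exI[of _ "(1 / norm a) *\<^sub>R a"]) simp
  then have "is_state cm st \<phi>"
    unfolding is_state_def using lin bound pos f(3) by auto
  then show thesis using phia by (rule that)
qed

end

section \<open>Compact operators have totally bounded image\<close>

lemma cmod_add_square_le: "(cmod (a + b))\<^sup>2 \<le> 2 * (cmod a)\<^sup>2 + 2 * (cmod b)\<^sup>2"
proof -
  have "(cmod (a + b))\<^sup>2 \<le> (cmod a + cmod b)\<^sup>2" by (simp add: norm_triangle_ineq power_mono)
  also have "\<dots> \<le> 2 * (cmod a)\<^sup>2 + 2 * (cmod b)\<^sup>2"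
    using zero_le_power2[of "cmod a - cmod b"] by (simp add: power2_eq_square algebra_simps)
  finally show ?thesis .
qed

text \<open>Induction on \<open>I\<close>: cover the disc of radius \<open>C\<close> by finitely
  many balls of radius \<open>\<eta> / 2\<close> and split \<open>Z\<close> by the ball containing
  \<open>f i z\<close>. The induction hypothesis is applied to each piece, so the net stays inside
  \<open>Z\<close>.\<close>

lemma finite_net_bounded_functions:
  fixes f :: "'i \<Rightarrow> 'z \<Rightarrow> complex"
  assumes "finite I" "0 < \<eta>" "\<And>i z. i \<in> I \<Longrightarrow> z \<in> Z \<Longrightarrow> cmod (f i z) \<le> C"
  shows "\<exists>S. finite S \<and> S \<subseteq> Z \<and> (\<forall>z\<in>Z. \<exists>s\<in>S. \<forall>i\<in>I. cmod (f i s - f i z) < \<eta>)"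
  using assms
proof (induction I arbitrary: Z rule: finite_induct)
  case empty
  show ?case
  proof (cases "Z = {}")
    case False
    then obtain s where "s \<in> Z" by blast
    then show ?thesis by (intro exI[of _ "{s}"]) auto
  qed auto
next
  case (insert i I)
  obtain T where T: "finite T" "cball (0::complex) C \<subseteq> (\<Union>t\<in>T. ball t (\<eta> / 2))"
    using compact_cball[of "0::complex" C, unfolded compact_eq_totally_bounded] insert.prems(1)
    by (meson half_gt_zero)
  define Zt where "Zt t = {z \<in> Z. f i z \<in> ball t (\<eta> / 2)}" for t
  have "\<exists>S. finite S \<and> S \<subseteq> Zt t \<and> (\<forall>z\<in>Zt t. \<exists>s\<in>S. \<forall>i\<in>I. cmod (f i s - f i z) < \<eta>)" for t
    using insert.prems by (intro insert.IH) (auto simp: Zt_def)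
  then obtain S where S: "\<And>t. finite (S t)" "\<And>t. S t \<subseteq> Zt t"
    "\<And>t z. z \<in> Zt t \<Longrightarrow> \<exists>s\<in>S t. \<forall>i\<in>I. cmod (f i s - f i z) < \<eta>" by metis
  show ?case
  proof (intro exI conjI ballI)
    show "finite (\<Union>t\<in>T. S t)" using T S by auto
    show "(\<Union>t\<in>T. S t) \<subseteq> Z" using S(2) by (auto simp: Zt_def)
    fix z assume z: "z \<in> Z"
    then have "f i z \<in> cball 0 C" using insert.prems by simp
    then obtain t where t: "t \<in> T" "f i z \<in> ball t (\<eta> / 2)" using T by blast
    then have zt: "z \<in> Zt t" using z by (simp add: Zt_def)
    then obtain s where s: "s \<in> S t" "\<forall>i\<in>I. cmod (f i s - f i z) < \<eta>" using S(3) by blast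
    have "f i s \<in> ball t (\<eta> / 2)" using s(1) S(2) by (auto simp: Zt_def)
    then have "dist (f i s) (f i z) < \<eta>"
      using t(2) dist_triangle_half_r[of t "f i s" \<eta> "f i z"] by simp
    then show "\<exists>s\<in>\<Union>t\<in>T. S t. \<forall>j\<in>insert i I. cmod (f j s - f j z) < \<eta>"
      using s t by (intro bexI[of _ s]) (auto simp: dist_norm)
  qed
qed

context cstar_alg
begin

text \<open>Let \<open>d\<close> be the sum of the \<open>c i\<close> weighted by the conjugates of
  \<open>\<phi> (c i)\<close>. Then \<open>\<phi> d = \<Lambda>\<close>, so
  \<open>\<Lambda> \<le> norm d\<close>. Positivity of the sum of the \<open>e i * st (e i)\<close>,
  with residuals \<open>e i\<close> of the \<open>c i\<close> along \<open>d\<close>, shows that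
  \<open>d * st d\<close> lies below \<open>\<Lambda>\<close> times the sum of the
  \<open>c i * st (c i)\<close>; compare norms.\<close>

lemma functional_square_sum_le:
  assumes add: "\<And>a b. \<phi> (a + b) = \<phi> a + \<phi> b" and scale: "\<And>z a. \<phi> (cm z a) = z * \<phi> a"
    and bd: "\<And>a. cmod (\<phi> a) \<le> norm a"
  shows "(\<Sum>i\<in>I. (cmod (\<phi> (c i)))\<^sup>2) \<le> norm (\<Sum>i\<in>I. c i * st (c i))"
proof -
  define \<Lambda> where "\<Lambda> = (\<Sum>i\<in>I. (cmod (\<phi> (c i)))\<^sup>2)"
  have nn: "0 \<le> \<Lambda>" unfolding \<Lambda>_def by (intro sum_nonneg) auto
  show ?thesis
  proof (cases "\<Lambda> = 0")
    case True
    then show ?thesis by (simp add: \<Lambda>_def)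
  next
    case False
    with nn have pos: "0 < \<Lambda>" by simp
    define L where "L = complex_of_real (1 / \<Lambda>)"
    have cL: "cnj L = L" by (simp add: L_def)
    have L1: "L * complex_of_real \<Lambda> = 1" using pos by (simp add: L_def)
    define d where "d = (\<Sum>i\<in>I. cm (cnj (\<phi> (c i))) (c i))"
    have phi0: "\<phi> 0 = 0" using add[of 0 0] by simp
    have phisum: "\<phi> (sum f J) = (\<Sum>i\<in>J. \<phi> (f i))" for f and J :: "'b set"
      by (induction J rule: infinite_finite_induct) (auto simp: add phi0)
    have sumsq: "(\<Sum>i\<in>I. \<phi> (c i) * cnj (\<phi> (c i))) = complex_of_real \<Lambda>"
      unfolding \<Lambda>_def of_real_sum by (intro sum.cong) (simp_all only: complex_norm_square)
    then have "\<phi> d = complex_of_real \<Lambda>" by (simp add: d_def phisum scale mult.commute)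
    then have "\<Lambda> \<le> norm d" using bd[of d] nn by simp
    then have "\<Lambda>\<^sup>2 \<le> (norm d)\<^sup>2" using nn by (intro power_mono)
    also have "\<dots> = norm (d * st d)" by (simp add: norm_mult_st)
    finally have low: "\<Lambda>\<^sup>2 \<le> norm (d * st d)" .
    have cmsum: "cm (sum f J) x = (\<Sum>i\<in>J. cm (f i) x)" for f x and J :: "'b set"
      using cm_of_real[of 0 x]
      by (induction J rule: infinite_finite_induct) (auto simp: cm_add_left)
    have std: "st d = (\<Sum>i\<in>I. cm (\<phi> (c i)) (st (c i)))" by (simp add: d_def st_sum st_cm)
    define e where "e i = c i - cm (L * \<phi> (c i)) d" for i
    have "e i * st (e i) = c i * st (c i) - cm L (cm (cnj (\<phi> (c i))) (c i) * st d)
        - cm L (d * cm (\<phi> (c i)) (st (c i))) + cm (L * L * (\<phi> (c i) * cnj (\<phi> (c i)))) (d * st d)" for i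
      by (simp add: e_def st_diff st_cm cL left_diff_distrib right_diff_distrib cm_mult_left
          cm_mult_right cm_cm cm_diff_right mult_ac)
    then have "(\<Sum>i\<in>I. e i * st (e i)) = (\<Sum>i\<in>I. c i * st (c i)) - cm L (d * st d)
        - cm L (d * st d) + cm (L * L * complex_of_real \<Lambda>) (d * st d)"
      by (simp add: sum.distrib sum_subtractf flip: cm_sum_right sum_distrib_right sum_distrib_left
          std d_def cmsum sumsq)
    also have "\<dots> = (\<Sum>i\<in>I. c i * st (c i)) - (1 / \<Lambda>) *\<^sub>R (d * st d)"
      using L1 by (simp add: mult.assoc L_def cm_of_real del: of_real_divide)
    finally have "cle st ((1 / \<Lambda>) *\<^sub>R (d * st d)) (\<Sum>i\<in>I. c i * st (c i))"
      unfolding cle_def by (metis (no_types, lifting) cpos_sum cpos_mult_st)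
    then have "norm ((1 / \<Lambda>) *\<^sub>R (d * st d)) \<le> norm (\<Sum>i\<in>I. c i * st (c i))"
      using pos by (intro norm_mono_cle cpos_scaleR cpos_mult_st) auto
    moreover have "\<Lambda> \<le> norm ((1 / \<Lambda>) *\<^sub>R (d * st d))"
      using low pos by (simp add: field_simps power2_eq_square)
    ultimately show ?thesis by (simp add: \<Lambda>_def)
  qed
qed

end

locale hilbert_mod = cstar_alg cm st
  for cm :: "complex \<Rightarrow> 'a::{real_normed_algebra,banach} \<Rightarrow> 'a" and st :: "'a \<Rightarrow> 'a" +
  fixes mcm :: "complex \<Rightarrow> 'm::banach \<Rightarrow> 'm" and ract :: "'m \<Rightarrow> 'a \<Rightarrow> 'm" and ip :: "'m \<Rightarrow> 'm \<Rightarrow> 'a"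
  assumes hilbert: "hilbert_module cm st mcm ract ip"
begin

section \<open>Inner product calculus and the Cauchy-Schwarz inequality\<close>

lemma mcm_of_real: "mcm (complex_of_real r) x = r *\<^sub>R x"
  and ract_cm: "ract x (cm z a) = mcm z (ract x a)"
  and ip_add_right: "ip x (y + w) = ip x y + ip x w"
  and ip_mcm_right: "ip x (mcm z y) = cm z (ip x y)"
  and ip_ract_right: "ip x (ract y a) = ip x y * a"
  and st_ip: "st (ip x y) = ip y x"
  and cpos_ip: "cpos st (ip x x)"
  and norm_eq_sqrt: "norm x = sqrt (norm (ip x x))"
  using hilbert unfolding hilbert_module_def by simp_all

lemma mcm_one [simp]: "mcm 1 x = x"
  using mcm_of_real[of 1 x] by simp

lemma ract_scaleR: "ract x (r *\<^sub>R a) = r *\<^sub>R ract x a"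
  by (metis cm_of_real mcm_of_real ract_cm)

lemma norm_ip_self: "norm (ip x x) = (norm x)\<^sup>2"
  using norm_eq_sqrt[of x] by simp

lemma ip_add_left: "ip (x + y) w = ip x w + ip y w"
  by (metis ip_add_right st_add st_ip)

lemma ip_ract_left: "ip (ract x a) y = st a * ip x y"
  by (metis ip_ract_right st_ip st_mult)

lemma ip_scaleR_right: "ip x (r *\<^sub>R y) = r *\<^sub>R ip x y"
  by (metis cm_of_real ip_mcm_right mcm_of_real)

lemma ip_scaleR_left: "ip (r *\<^sub>R x) y = r *\<^sub>R ip x y"
  by (metis ip_scaleR_right st_scaleR st_ip)

lemma ip_zero_right [simp]: "ip x 0 = 0"
  using ip_add_right[of x 0 0] by simp

lemma ip_zero_left [simp]: "ip 0 x = 0"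
  using ip_add_left[of 0 0 x] by simp

lemma ip_minus_right: "ip x (- y) = - ip x y"
  using ip_add_right[of x y "- y"] by (simp add: eq_neg_iff_add_eq_0 add.commute)

lemma ip_minus_left: "ip (- x) y = - ip x y"
  using ip_add_left[of x "- x" y] by (simp add: eq_neg_iff_add_eq_0 add.commute)

lemma ip_diff_right: "ip x (y - w) = ip x y - ip x w"
  using ip_add_right[of x y "- w"] by (simp add: ip_minus_right)

lemma ip_diff_left: "ip (x - y) w = ip x w - ip y w"
  using ip_add_left[of x "- y" w] by (simp add: ip_minus_left)

lemma ip_sum_right: "ip x (sum f I) = (\<Sum>i\<in>I. ip x (f i))"
  by (induction I rule: infinite_finite_induct) (auto simp: ip_add_right)

lemma ip_sum_left: "ip (sum f I) x = (\<Sum>i\<in>I. ip (f i) x)"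
  by (induction I rule: infinite_finite_induct) (auto simp: ip_add_left)

lemma cpos_ip_mult_ip: "cpos st (ip x y * ip y x)"
  using cpos_st_mult[of "ip y x"] by (simp add: st_ip)

lemma norm_ip_mult_ip: "norm (ip x y * ip y x) = (norm (ip x y))\<^sup>2"
  using norm_mult_st[of "ip x y"] by (simp add: st_ip)

text \<open>Expand the positive element \<open>ip z z\<close> for \<open>z = y a - n x\<close> with
  \<open>a = ip y x\<close> and \<open>n\<close> the square of \<open>norm y\<close>, bound
  \<open>st a * ip y y * a\<close> by \<open>n (st a * a)\<close>, and divide by
  \<open>n\<close>.\<close>

lemma cauchy_schwarz_cle: "cle st (ip x y * ip y x) ((norm y)\<^sup>2 *\<^sub>R ip x x)"
proof (cases "norm y = 0")
  case True
  then show ?thesis by (simp add: cle_def)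
next
  case False
  define n where "n = (norm y)\<^sup>2"
  have n: "0 < n" using False by (simp add: n_def)
  define a where "a = ip y x"
  have sa: "ip x y = st a" "ip y x = a" by (simp_all add: a_def st_ip)
  have dbl: "(2 * n) *\<^sub>R (st a * a) = n *\<^sub>R (st a * a) + n *\<^sub>R (st a * a)"
    by (simp flip: scaleR_add_left)
  have "ip (ract y a - n *\<^sub>R x) (ract y a - n *\<^sub>R x)
      = st a * ip y y * a - (2 * n) *\<^sub>R (st a * a) + (n * n) *\<^sub>R ip x x"
    unfolding dbl
    by (simp add: ip_diff_left ip_diff_right ip_ract_left ip_ract_right ip_scaleR_left ip_scaleR_right
        sa algebra_simps)
  then have "cpos st (st a * ip y y * a - (2 * n) *\<^sub>R (st a * a) + (n * n) *\<^sub>R ip x x)"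
    using cpos_ip by metis
  moreover have "cpos st (n *\<^sub>R (st a * a) - st a * ip y y * a)"
    using cle_conj_norm[OF cpos_ip[of y], of a] by (simp add: cle_def norm_ip_self n_def)
  ultimately have "cpos st ((st a * ip y y * a - (2 * n) *\<^sub>R (st a * a) + (n * n) *\<^sub>R ip x x)
      + (n *\<^sub>R (st a * a) - st a * ip y y * a))"
    by (rule cpos_add)
  then have "cpos st ((n * n) *\<^sub>R ip x x - n *\<^sub>R (st a * a))"
    unfolding dbl by (simp add: algebra_simps)
  from cpos_scaleR[OF this, of "1/n"] show ?thesis
    using n by (simp add: cle_def scaleR_diff_right sa flip: n_def)
qed

lemma norm_ip_le: "norm (ip x y) \<le> norm x * norm y"
proof -
  have "(norm (ip x y))\<^sup>2 \<le> norm ((norm y)\<^sup>2 *\<^sub>R ip x x)"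
    using norm_mono_cle[OF cpos_ip_mult_ip cauchy_schwarz_cle, of x y] by (simp add: norm_ip_mult_ip)
  also have "\<dots> = (norm x * norm y)\<^sup>2" by (simp add: norm_ip_self power_mult_distrib)
  finally show ?thesis by (rule power2_le_imp_le) simp
qed

section \<open>Blocks and tails of admissible systems\<close>

lemma admissible_block_cle:
  assumes "admissible st ip UNIV X"
  shows "cle st (\<Sum>i=n..<m. ip x (X i) * ip (X i) x) (ip x x)"
proof -
  have "(\<Sum>i<m. ip x (X i) * ip (X i) x) - (\<Sum>i=n..<m. ip x (X i) * ip (X i) x)
      = (\<Sum>i\<in>{..<m} - {n..<m}. ip x (X i) * ip (X i) x)"
    by (subst sum_diff) auto
  then have "cle st (\<Sum>i=n..<m. ip x (X i) * ip (X i) x) (\<Sum>i<m. ip x (X i) * ip (X i) x)"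
    unfolding cle_def by (simp add: cpos_sum cpos_ip_mult_ip)
  then show ?thesis using assms cle_trans unfolding admissible_def by blast
qed

lemma state_block_le:
  assumes "is_state cm st \<phi>"
  shows "(\<Sum>i\<in>I. (cmod (\<phi> (ip x (X i))))\<^sup>2) \<le> norm (\<Sum>i\<in>I. ip x (X i) * ip (X i) x)"
  using functional_square_sum_le[of \<phi> "\<lambda>i. ip x (X i)" I] assms
  unfolding is_state_def by (simp add: st_ip)

lemma state_block_le_norm:
  assumes "is_state cm st \<phi>" "admissible st ip UNIV X"
  shows "(\<Sum>i=n..<m. (cmod (\<phi> (ip x (X i))))\<^sup>2) \<le> (norm x)\<^sup>2"
proof -
  have "norm (\<Sum>i=n..<m. ip x (X i) * ip (X i) x) \<le> norm (ip x x)"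
    by (intro norm_mono_cle cpos_sum cpos_ip_mult_ip admissible_block_cle assms)
  with state_block_le[OF assms(1)] show ?thesis unfolding norm_ip_self by (rule order_trans)
qed

text \<open>Tails are measured by finite blocks and uniformly over all states, so one threshold
  \<open>K\<close> serves every family of states.\<close>

definition uniform_tails :: "(nat \<Rightarrow> 'm) \<Rightarrow> 'z set \<Rightarrow> ('z \<Rightarrow> 'm) \<Rightarrow> bool" where
  "uniform_tails X B G \<longleftrightarrow> (\<forall>\<epsilon>>0. \<exists>K. \<forall>n\<ge>K. \<forall>m \<phi>. \<forall>z\<in>B. is_state cm st \<phi> \<longrightarrow>
     (\<Sum>i=n..<m. (cmod (\<phi> (ip (G z) (X i))))\<^sup>2) \<le> \<epsilon>)"

lemma state_block_add_le:
  assumes "is_state cm st \<phi>"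
  shows "(\<Sum>i\<in>I. (cmod (\<phi> (ip (x + y) (X i))))\<^sup>2)
    \<le> 2 * (\<Sum>i\<in>I. (cmod (\<phi> (ip x (X i))))\<^sup>2) + 2 * (\<Sum>i\<in>I. (cmod (\<phi> (ip y (X i))))\<^sup>2)"
proof -
  have "\<phi> (ip (x + y) w) = \<phi> (ip x w) + \<phi> (ip y w)" for w
    using assms by (simp add: is_state_def ip_add_left)
  then show ?thesis
    unfolding sum_distrib_left sum.distrib[symmetric]
    by (intro sum_mono) (simp add: cmod_add_square_le)
qed

lemma uniform_tails_add:
  assumes "uniform_tails X B G" "uniform_tails X B H"
  shows "uniform_tails X B (\<lambda>z. G z + H z)"
  unfolding uniform_tails_def
proof (intro allI impI)
  fix \<epsilon> :: real assume "0 < \<epsilon>"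
  then have "0 < \<epsilon> / 4" by simp
  then obtain K L where
    K: "\<And>n m \<phi> z. K \<le> n \<Longrightarrow> z \<in> B \<Longrightarrow> is_state cm st \<phi> \<Longrightarrow>
      (\<Sum>i=n..<m. (cmod (\<phi> (ip (G z) (X i))))\<^sup>2) \<le> \<epsilon> / 4" and
    L: "\<And>n m \<phi> z. L \<le> n \<Longrightarrow> z \<in> B \<Longrightarrow> is_state cm st \<phi> \<Longrightarrow>
      (\<Sum>i=n..<m. (cmod (\<phi> (ip (H z) (X i))))\<^sup>2) \<le> \<epsilon> / 4"
    using assms unfolding uniform_tails_def by meson
  show "\<exists>K. \<forall>n\<ge>K. \<forall>m \<phi>. \<forall>z\<in>B. is_state cm st \<phi> \<longrightarrow>
      (\<Sum>i=n..<m. (cmod (\<phi> (ip (G z + H z) (X i))))\<^sup>2) \<le> \<epsilon>"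
  proof (intro exI[of _ "max K L"] allI impI ballI)
    fix n m \<phi> z assume a: "max K L \<le> n" "z \<in> B" "is_state cm st \<phi>"
    show "(\<Sum>i=n..<m. (cmod (\<phi> (ip (G z + H z) (X i))))\<^sup>2) \<le> \<epsilon>"
      using state_block_add_le[OF a(3), where I = "{n..<m}" and x = "G z" and y = "H z" and X = X] K[of n z \<phi> m] L[of n z \<phi> m] a by simp
  qed
qed

text \<open>The error contributes at most the square of its norm to any block. The constants
  \<open>\<epsilon> / 4\<close> compensate the factor 2 in the square of a sum.\<close>

lemma uniform_tails_approx:
  assumes X: "admissible st ip UNIV X"
    and app: "\<And>\<delta>. 0 < \<delta> \<Longrightarrow> \<exists>H. uniform_tails X B H \<and> (\<forall>z\<in>B. norm (G z - H z) \<le> \<delta>)"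
  shows "uniform_tails X B G"
  unfolding uniform_tails_def
proof (intro allI impI)
  fix \<epsilon> :: real assume \<epsilon>: "0 < \<epsilon>"
  then obtain H where H: "uniform_tails X B H" "\<And>z. z \<in> B \<Longrightarrow> norm (G z - H z) \<le> sqrt (\<epsilon> / 4)"
    using app[of "sqrt (\<epsilon> / 4)"] by auto
  have "0 < \<epsilon> / 4" using \<epsilon> by simp
  then obtain K where
    K: "\<And>n m \<phi> z. K \<le> n \<Longrightarrow> z \<in> B \<Longrightarrow> is_state cm st \<phi> \<Longrightarrow>
      (\<Sum>i=n..<m. (cmod (\<phi> (ip (H z) (X i))))\<^sup>2) \<le> \<epsilon> / 4"
    using H(1) unfolding uniform_tails_def by meson
  show "\<exists>K. \<forall>n\<ge>K. \<forall>m \<phi>. \<forall>z\<in>B. is_state cm st \<phi> \<longrightarrow>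
      (\<Sum>i=n..<m. (cmod (\<phi> (ip (G z) (X i))))\<^sup>2) \<le> \<epsilon>"
  proof (intro exI[of _ K] allI impI ballI)
    fix n m \<phi> z assume a: "K \<le> n" "z \<in> B" "is_state cm st \<phi>"
    have "(norm (G z - H z))\<^sup>2 \<le> (sqrt (\<epsilon> / 4))\<^sup>2" using H(2)[OF a(2)] by (intro power_mono) auto
    also have "\<dots> = \<epsilon> / 4" using \<epsilon> by simp
    finally have "(\<Sum>i=n..<m. (cmod (\<phi> (ip (G z - H z) (X i))))\<^sup>2) \<le> \<epsilon> / 4"
      using state_block_le_norm[OF a(3) X] order_trans by blast
    then show "(\<Sum>i=n..<m. (cmod (\<phi> (ip (G z) (X i))))\<^sup>2) \<le> \<epsilon>"
      using state_block_add_le[OF a(3), where I = "{n..<m}" and x = "G z - H z" and y = "H z" and X = X] K[OF a, of m] by simp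
  qed
qed

text \<open>Pulling out the coefficient turns a block of \<open>w a\<close> into
  \<open>st a * S * a\<close> with \<open>S\<close> the block of \<open>w\<close>, so convergence
  for the single vector \<open>w\<close> is uniform over bounded coefficients.\<close>

lemma uniform_tails_ract:
  assumes X: "admissible st ip UNIV X" and a: "\<And>z. z \<in> B \<Longrightarrow> norm (a z) \<le> C"
  shows "uniform_tails X B (\<lambda>z. ract w (a z))"
  unfolding uniform_tails_def
proof (intro allI impI)
  fix \<epsilon> :: real assume \<epsilon>: "0 < \<epsilon>"
  define D where "D = C\<^sup>2 + 1"
  have D: "0 < D" by (simp add: D_def add_nonneg_pos)
  have "summable (\<lambda>i. ip w (X i) * ip (X i) w)" using X by (simp add: admissible_def)
  then obtain K where K: "\<And>n m. K \<le> n \<Longrightarrow> norm (\<Sum>i=n..<m. ip w (X i) * ip (X i) w) < \<epsilon> / D"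
    unfolding summable_Cauchy using \<epsilon> D by (meson divide_pos_pos)
  show "\<exists>K. \<forall>n\<ge>K. \<forall>m \<phi>. \<forall>z\<in>B. is_state cm st \<phi> \<longrightarrow>
      (\<Sum>i=n..<m. (cmod (\<phi> (ip (ract w (a z)) (X i))))\<^sup>2) \<le> \<epsilon>"
  proof (intro exI[of _ K] allI impI ballI)
    fix n m \<phi> z assume h: "K \<le> n" "z \<in> B" "is_state cm st \<phi>"
    let ?S = "\<Sum>i=n..<m. ip w (X i) * ip (X i) w"
    have "(\<Sum>i=n..<m. (cmod (\<phi> (ip (ract w (a z)) (X i))))\<^sup>2)
        \<le> norm (\<Sum>i=n..<m. ip (ract w (a z)) (X i) * ip (X i) (ract w (a z)))"
      by (rule state_block_le[OF h(3)])
    also have "(\<Sum>i=n..<m. ip (ract w (a z)) (X i) * ip (X i) (ract w (a z))) = st (a z) * ?S * a z"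
      by (simp add: ip_ract_left ip_ract_right sum_distrib_left sum_distrib_right mult.assoc)
    also have "norm \<dots> \<le> norm (st (a z) * ?S) * norm (a z)" by (rule norm_mult_ineq)
    also have "\<dots> \<le> norm (st (a z)) * norm ?S * norm (a z)"
      by (intro mult_right_mono norm_mult_ineq norm_ge_zero)
    also have "\<dots> = (norm (a z))\<^sup>2 * norm ?S" by (simp add: power2_eq_square)
    also have "\<dots> \<le> D * (\<epsilon> / D)"
    proof (rule mult_mono)
      have "(norm (a z))\<^sup>2 \<le> C\<^sup>2" using a[OF h(2)] by (intro power_mono) auto
      then show "(norm (a z))\<^sup>2 \<le> D" by (simp add: D_def)
    qed (use K[OF h(1), of m] D in auto)
    finally show "(\<Sum>i=n..<m. (cmod (\<phi> (ip (ract w (a z)) (X i))))\<^sup>2) \<le> \<epsilon>" using D by simp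
  qed
qed

lemma uniform_tails_zero: "uniform_tails X B (\<lambda>z. 0)"
proof -
  have zero: "\<phi> 0 = 0" if "is_state cm st \<phi>" for \<phi>
    using that unfolding is_state_def by (metis add_cancel_right_right)
  show ?thesis unfolding uniform_tails_def
    by (intro allI impI exI[of _ 0] ballI) (simp add: zero less_imp_le)
qed

lemma uniform_tails_sum:
  assumes "\<And>j. j \<in> J \<Longrightarrow> uniform_tails X B (G j)"
  shows "uniform_tails X B (\<lambda>z. \<Sum>j\<in>J. G j z)"
  using assms
  by (induction J rule: infinite_finite_induct) (auto intro: uniform_tails_zero uniform_tails_add)

text \<open>A sum starting at \<open>k \<ge> K\<close> is a tail, small for every state. For
  \<open>k < K\<close> only indices \<open>i < K\<close> remain besides a tail, so
  \<open>K * K\<close> bounded scalar functions control the distance, and these admit a finite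
  net.\<close>

lemma finite_net_of_uniform_tails:
  assumes ut: "uniform_tails X B G" and bd: "\<And>z. z \<in> B \<Longrightarrow> norm (G z) \<le> C"
    and \<Phi>: "\<And>k. is_state cm st (\<Phi> k)" and \<epsilon>: "0 < \<epsilon>"
  shows "\<exists>S. finite S \<and> S \<subseteq> G ` B \<and> (\<forall>y\<in>G ` B. \<exists>s\<in>S. dXPhi_sq ip X \<Phi> s y < ennreal (\<epsilon>\<^sup>2))"
proof -
  have "0 < \<epsilon>\<^sup>2 / 16" using \<epsilon> by simp
  then obtain K where
    K: "\<And>n m \<phi> z. K \<le> n \<Longrightarrow> z \<in> B \<Longrightarrow> is_state cm st \<phi> \<Longrightarrow>
      (\<Sum>i=n..<m. (cmod (\<phi> (ip (G z) (X i))))\<^sup>2) \<le> \<epsilon>\<^sup>2 / 16"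
    using ut unfolding uniform_tails_def by meson
  \<comment> \<open>At most \<open>K\<close> coordinates contribute \<open>\<eta>^2\<close> each,
    together at most \<open>\<epsilon>^2 / 4\<close>.\<close>
  define \<eta> where "\<eta> = \<epsilon> / (2 * (real K + 1))"
  have \<eta>: "0 < \<eta>" using \<epsilon> by (simp add: \<eta>_def)
  define I where "I = {..<K} \<times> {..<K}"
  define f where "f p z = (case p of (k, i) \<Rightarrow> \<Phi> k (ip (G z) (X i)))" for p z
  define M where "M = (\<Sum>i<K. \<bar>C\<bar> * norm (X i))"
  have "cmod (f p z) \<le> M" if pz: "p \<in> I" "z \<in> B" for p z
  proof -
    obtain k i where p: "p = (k, i)" "i < K" using pz(1) unfolding I_def by blast
    have "cmod (f p z) \<le> norm (ip (G z) (X i))" using \<Phi>[of k] by (simp add: f_def p is_state_def)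
    also have "\<dots> \<le> norm (G z) * norm (X i)" by (rule norm_ip_le)
    also have "\<dots> \<le> \<bar>C\<bar> * norm (X i)" using bd[OF pz(2)] by (intro mult_right_mono) auto
    also have "\<dots> \<le> M" unfolding M_def using p(2) by (intro member_le_sum) auto
    finally show ?thesis .
  qed
  with finite_net_bounded_functions[of I \<eta> B f M] \<eta>
  obtain S where S: "finite S" "S \<subseteq> B" "\<And>z. z \<in> B \<Longrightarrow> \<exists>s\<in>S. \<forall>p\<in>I. cmod (f p s - f p z) < \<eta>"
    by (auto simp: I_def)
  have "dXPhi_sq ip X \<Phi> (G s) (G z) < ennreal (\<epsilon>\<^sup>2)"
    if s: "s \<in> B" "z \<in> B" "\<forall>p\<in>I. cmod (f p s - f p z) < \<eta>" for s z
  proof -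
    define g where "g k i = (cmod (\<Phi> k (ip (G s - G z) (X i))))\<^sup>2" for k i
    have phidiff: "\<Phi> k (ip (G s - G z) w) = \<Phi> k (ip (G s) w) - \<Phi> k (ip (G z) w)" for k w
      using \<Phi>[of k] unfolding is_state_def by (metis ip_diff_left add_diff_cancel diff_add_cancel)
    \<comment> \<open>Twice \<open>\<epsilon>^2 / 16\<close> from each of the two points.\<close>
    have tail: "(\<Sum>i=n..<m. g k i) \<le> \<epsilon>\<^sup>2 / 4" if "K \<le> n" for n m k
    proof -
      have "g k i \<le> 2 * (cmod (\<Phi> k (ip (G s) (X i))))\<^sup>2 + 2 * (cmod (\<Phi> k (ip (G z) (X i))))\<^sup>2" for i
        unfolding g_def phidiff
        using cmod_add_square_le[of "\<Phi> k (ip (G s) (X i))" "- \<Phi> k (ip (G z) (X i))"] by simp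
      then have "(\<Sum>i=n..<m. g k i) \<le> 2 * (\<Sum>i=n..<m. (cmod (\<Phi> k (ip (G s) (X i))))\<^sup>2)
          + 2 * (\<Sum>i=n..<m. (cmod (\<Phi> k (ip (G z) (X i))))\<^sup>2)"
        unfolding sum_distrib_left sum.distrib[symmetric] by (rule sum_mono)
      then show ?thesis using K[OF that s(1) \<Phi>, of k m] K[OF that s(2) \<Phi>, of k m] by linarith
    qed
    have block: "(\<Sum>i=k..<m. g k i) \<le> \<epsilon>\<^sup>2 / 2" for k m
    proof (cases "K \<le> k")
      case True
      then show ?thesis using tail[of k k m] zero_le_power2[of \<epsilon>] by linarith
    next
      case False
      have "(\<Sum>i=k..<m. g k i) \<le> (\<Sum>i\<in>{..<K} \<union> {K..<m}. g k i)"
        by (intro sum_mono2) (auto simp: g_def)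
      also have "\<dots> = (\<Sum>i<K. g k i) + (\<Sum>i=K..<m. g k i)"
        by (intro sum.union_disjoint) auto
      also have "(\<Sum>i<K. g k i) \<le> (\<Sum>i<K. \<eta>\<^sup>2)"
      proof (rule sum_mono)
        fix i assume "i \<in> {..<K}"
        then have "(k, i) \<in> I" using False by (simp add: I_def)
        then have "cmod (f (k, i) s - f (k, i) z) < \<eta>" using s(3) by blast
        then show "g k i \<le> \<eta>\<^sup>2" unfolding g_def phidiff by (intro power_mono) (auto simp: f_def)
      qed
      also have "(\<Sum>i<K. \<eta>\<^sup>2) \<le> \<epsilon>\<^sup>2 / 4"
      proof -
        define \<kappa> where "\<kappa> = (real K + 1)\<^sup>2"
        have \<kappa>: "0 < \<kappa>" "real K \<le> \<kappa>" by (auto simp: \<kappa>_def power2_eq_square algebra_simps add_pos_nonneg)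
        have "\<eta>\<^sup>2 = \<epsilon>\<^sup>2 / (4 * \<kappa>)" unfolding \<eta>_def \<kappa>_def power_divide power_mult_distrib by simp
        then have "\<kappa> * \<eta>\<^sup>2 = \<epsilon>\<^sup>2 / 4" using \<kappa>(1) by simp
        moreover have "real K * \<eta>\<^sup>2 \<le> \<kappa> * \<eta>\<^sup>2" using \<kappa>(2) by (intro mult_right_mono) auto
        ultimately show ?thesis by simp
      qed
      finally show ?thesis using tail[of K k m] by simp
    qed
    \<comment> \<open>Half of \<open>\<epsilon>^2\<close> leaves room for a strict inequality after
      the supremum.\<close>
    have "dXPhi_sq ip X \<Phi> (G s) (G z) \<le> ennreal (\<epsilon>\<^sup>2 / 2)"
      unfolding dXPhi_sq_def
    proof (intro SUP_least suminf_le_const summableI)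
      fix k n
      have "(\<Sum>j<n. ennreal (g k (k + j))) = ennreal (\<Sum>j<n. g k (k + j))"
        by (simp add: g_def sum_ennreal)
      also have "(\<Sum>j<n. g k (k + j)) = (\<Sum>i=k..<k + n. g k i)"
        by (simp add: sum.atLeastLessThan_shift_0[of _ k] lessThan_atLeast0 add.commute)
      also have "ennreal \<dots> \<le> ennreal (\<epsilon>\<^sup>2 / 2)" by (intro ennreal_leI block)
      finally show "(\<Sum>j<n. ennreal ((cmod (\<Phi> k (ip (G s - G z) (X (k + j)))))\<^sup>2)) \<le> ennreal (\<epsilon>\<^sup>2 / 2)"
        by (simp add: g_def)
    qed
    also have "\<dots> < ennreal (\<epsilon>\<^sup>2)" using \<epsilon> by (intro ennreal_lessI) auto
    finally show ?thesis .
  qed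
  note net = this
  show ?thesis
  proof (intro exI[of _ "G ` S"] conjI ballI)
    fix y assume "y \<in> G ` B"
    then obtain z where z: "z \<in> B" "y = G z" by blast
    obtain s where s: "s \<in> S" "\<forall>p\<in>I. cmod (f p s - f p z) < \<eta>" using S(3)[OF z(1)] by blast
    then have "s \<in> B" using S(2) by blast
    from net[OF this z(1) s(2)] s(1) show "\<exists>s\<in>G ` S. dXPhi_sq ip X \<Phi> s y < ennreal (\<epsilon>\<^sup>2)"
      by (simp add: z(2) bexI)
  qed (use S(1,2) in auto)
qed

end

section \<open>Parseval frames\<close>

context cstar_alg
begin

text \<open>The element is \<open>h (1 - h)^2 = (1 - h) E\<close> with \<open>E = h (1 - h)\<close>.
  Both \<open>E\<close> and \<open>1 - 2 E = (1 - h)^2 + h^2\<close> are positive, so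
  \<open>norm E \<le> 1 / 2\<close>, and multiplication by \<open>1 - h\<close> does not increase
  norms.\<close>

lemma norm_cubic_le:
  assumes "cpos st h" "norm h \<le> 1"
  shows "norm (h - 2 *\<^sub>R (h * h) + h * h * h) \<le> 1 / 2"
proof -
  have h: "upos 0 h" "st h = h" using assms by (simp_all add: cpos_iff_upos cpos_selfadjoint)
  obtain q where q: "q * q = h" "upos 0 q" by (rule upos_zero_sqrt[OF h(1)]) (rule that)
  have sq: "st q = q" using q by (simp add: upos_def)
  define E where "E = h - h * h"
  have "st q * h * q = h * h" by (simp add: sq q(1)[symmetric] mult.assoc)
  then have "cpos st (norm h *\<^sub>R h - h * h)"
    using cle_conj_norm[OF assms(1), of q] by (simp add: cle_def sq q(1))
  moreover have "cpos st ((1 - norm h) *\<^sub>R h)" using assms by (intro cpos_scaleR) auto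
  ultimately have "cpos st ((norm h *\<^sub>R h - h * h) + (1 - norm h) *\<^sub>R h)" by (rule cpos_add)
  then have E: "cpos st E" by (simp add: E_def algebra_simps)
  have "upos 1 (- (2 *\<^sub>R h) + h * h)" using upos_square[of "- h" 1] h by (simp add: st_minus)
  moreover have "upos 0 (h * h)" using h by (intro upos_selfadjoint_square)
  ultimately have "upos (1 + 0) ((- (2 *\<^sub>R h) + h * h) + h * h)" by (rule upos_add)
  then have "upos 1 (- (2 *\<^sub>R E))" by (simp add: E_def scaleR_2 algebra_simps)
  moreover have "upos 0 (2 *\<^sub>R E)" using cpos_scaleR[OF E, of 2] by (simp add: cpos_iff_upos)
  ultimately have "norm (2 *\<^sub>R E) \<le> 1" by (intro norm_le_of_upos) auto
  then have nE: "norm E \<le> 1 / 2" by simp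
  have "norm ((norm h - 0) *\<^sub>R y - h * y) \<le> norm h * norm y" for y
    using upos_bound[OF h(1)] by simp
  from upos_bound_mono[OF this assms(2)] have "norm ((1 - 0) *\<^sub>R E - h * E) \<le> 1 * norm E" .
  moreover have "h - 2 *\<^sub>R (h * h) + h * h * h = (1 - 0) *\<^sub>R E - h * E"
    by (simp add: E_def scaleR_2 algebra_simps)
  ultimately show ?thesis using nE by simp
qed

end

section \<open>Splitting rank-one pieces off a positive operator\<close>

context hilbert_mod
begin

text \<open>Additivity and module linearity are contained in the symmetry: to use them,
  \<open>Q\<close> is moved into the other slot of the inner product.\<close>

definition pos_operator :: "('m \<Rightarrow> 'm) \<Rightarrow> bool" where
  "pos_operator Q \<longleftrightarrow> (\<forall>x y. ip x (Q y) = ip (Q x) y) \<and> (\<forall>x. cpos st (ip x (Q x)))"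

text \<open>With \<open>b = ip g (Q g)\<close>, \<open>\<beta> = norm b\<close> and
  \<open>h = b / \<beta>\<close>, let \<open>v\<close> be \<open>Q g\<close> times the root of
  \<open>2 - h\<close>, divided by \<open>sqrt \<beta>\<close>. The new form at \<open>x\<close> is
  the old one at a shifted vector \<open>x - g c\<close>, hence positive; at \<open>g\<close> it is
  \<open>\<beta> h (1 - h)^2\<close>, of norm at most \<open>\<beta> / 2\<close>.\<close>

lemma frame_step:
  assumes Q: "pos_operator Q"
  obtains v where "pos_operator (\<lambda>y. Q y - ract v (ip v y))"
    "norm (ip g (Q g - ract v (ip v g))) \<le> norm (ip g (Q g)) / 2"
proof -
  have sym: "ip x (Q y) = ip (Q x) y" and pos: "cpos st (ip x (Q x))" for x y
    using Q by (auto simp: pos_operator_def)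
  define b where "b = ip g (Q g)"
  define \<beta> where "\<beta> = norm b"
  have sym': "ip x (Q y - ract v (ip v y)) = ip (Q x - ract v (ip v x)) y" for v x y
    by (simp add: ip_diff_left ip_diff_right ip_ract_left ip_ract_right st_ip sym)
  show thesis
  proof (cases "\<beta> = 0")
    case True
    then have b0: "ip g (Q g) = 0" by (simp add: \<beta>_def b_def)
    show thesis
    proof (rule that[of 0])
      show "pos_operator (\<lambda>y. Q y - ract 0 (ip 0 y))"
        using sym'[of _ _ 0] pos by (auto simp: pos_operator_def ip_diff_right ip_ract_right)
      show "norm (ip g (Q g - ract 0 (ip 0 g))) \<le> norm (ip g (Q g)) / 2"
        by (simp add: ip_diff_right ip_ract_right b0)
    qed
  next
    case False
    then have \<beta>: "0 < \<beta>" by (simp add: \<beta>_def)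
    define h where "h = (1 / \<beta>) *\<^sub>R b"
    have bh: "b = \<beta> *\<^sub>R h" using \<beta> by (simp add: h_def)
    have h: "cpos st h" "norm h = 1"
      using pos \<beta> by (auto simp: h_def b_def intro!: cpos_scaleR) (simp_all add: \<beta>_def b_def)
    then have "upos 2 (- h)" by (intro upos_of_norm_le) (simp_all add: st_minus cpos_selfadjoint)
    moreover have "(0::real) \<le> 2" by simp
    ultimately obtain \<sigma> f where f: "\<sigma>\<^sup>2 = 2" "(2 * \<sigma>) *\<^sub>R f + f * f = - h" "upos \<sigma> f"
      by (rule upos_sqrt) (rule that)
    have sf: "st f = f" using f by (simp add: upos_def)
    define r where "r = 1 / sqrt \<beta>"
    have rr: "r * r = 1 / \<beta>" using \<beta> by (simp add: r_def)
    define v where "v = r *\<^sub>R (\<sigma> *\<^sub>R Q g + ract (Q g) f)"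
    have vv: "ip x v * ip v y = (1 / \<beta>) *\<^sub>R (2 *\<^sub>R (ip x (Q g) * ip (Q g) y) - ip x (Q g) * h * ip (Q g) y)"
      for x y
    proof -
      have dbl: "(2 * \<sigma>) *\<^sub>R f = \<sigma> *\<^sub>R f + \<sigma> *\<^sub>R f" by (simp flip: scaleR_add_left)
      have "ip x v * ip v y
          = (r * r) *\<^sub>R (\<sigma>\<^sup>2 *\<^sub>R (ip x (Q g) * ip (Q g) y) + ip x (Q g) * ((2 * \<sigma>) *\<^sub>R f + f * f) * ip (Q g) y)"
        unfolding dbl by (simp add: v_def ip_scaleR_left ip_scaleR_right ip_add_left ip_add_right
            ip_ract_left ip_ract_right sf algebra_simps power2_eq_square)
      then show ?thesis unfolding f rr by (simp add: algebra_simps)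
    qed
    show thesis
    proof (rule that[of v])
      have "cpos st (ip x (Q x - ract v (ip v x)))" for x
      proof -
        \<comment> \<open>Completing the square: with this coefficient \<open>ip x' (Q x')\<close>
          is exactly the form left after subtracting \<open>v\<close>.\<close>
        define c where "c = (1 / \<beta>) *\<^sub>R ip (Q g) x"
        define x' where "x' = x - ract g c"
        have sc: "st c = (1 / \<beta>) *\<^sub>R ip x (Q g)" by (simp add: c_def st_scaleR st_ip)
        have "ip x' (Q x') = ip (Q x') x'" by (simp add: sym)
        also have "\<dots> = ip x' (Q x) - ip x' (Q g) * c"
          by (simp add: x'_def ip_diff_right ip_ract_right sym)
        also have "\<dots> = ip x (Q x) - st c * ip (Q g) x - ip x (Q g) * c + st c * b * c"
          by (simp add: x'_def ip_diff_left ip_ract_left sym[of g x] b_def algebra_simps)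
        also have "\<dots> = ip x (Q x) - ip x v * ip v x"
          unfolding vv sc bh using \<beta> by (simp add: c_def algebra_simps scaleR_2)
        finally have "ip x' (Q x') = ip x (Q x - ract v (ip v x))"
          by (simp add: ip_diff_right ip_ract_right)
        then show ?thesis using pos[of x'] by simp
      qed
      then show "pos_operator (\<lambda>y. Q y - ract v (ip v y))"
        using sym' by (simp add: pos_operator_def)
      have "ip g (Q g - ract v (ip v g)) = b - ip g v * ip v g"
        by (simp add: ip_diff_right ip_ract_right b_def)
      also have "\<dots> = \<beta> *\<^sub>R (h - 2 *\<^sub>R (h * h) + h * h * h)"
        unfolding vv sym[symmetric] b_def[symmetric] bh using \<beta> by (simp add: algebra_simps)
      finally have "norm (ip g (Q g - ract v (ip v g))) = \<beta> * norm (h - 2 *\<^sub>R (h * h) + h * h * h)"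
        using \<beta> by simp
      also have "\<dots> \<le> \<beta> * (1 / 2)" using norm_cubic_le[of h] h \<beta> by (intro mult_left_mono) auto
      finally show "norm (ip g (Q g - ract v (ip v g))) \<le> norm (ip g (Q g)) / 2"
        by (simp add: \<beta>_def b_def)
    qed
  qed
qed

text \<open>Parallelogram identity for the form of \<open>Q\<close>, with the positive term at
  \<open>x - y\<close> dropped.\<close>

lemma pos_operator_norm_add_le:
  assumes "pos_operator Q"
  shows "norm (ip (x + y) (Q (x + y))) \<le> 2 * norm (ip x (Q x)) + 2 * norm (ip y (Q y))"
proof -
  have sym: "ip x (Q y) = ip (Q x) y" and pos: "cpos st (ip x (Q x))" for x y
    using assms by (auto simp: pos_operator_def)
  have "ip (x + y) (Q (x + y)) + ip (x - y) (Q (x - y)) = 2 *\<^sub>R ip x (Q x) + 2 *\<^sub>R ip y (Q y)"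
    unfolding sym[of "x + y"] sym[of "x - y"]
    by (simp add: ip_add_right ip_diff_right sym[symmetric])
       (simp add: ip_add_left ip_diff_left scaleR_2)
  then have "cle st (ip (x + y) (Q (x + y))) (2 *\<^sub>R ip x (Q x) + 2 *\<^sub>R ip y (Q y))"
    unfolding cle_def by (metis add_diff_cancel_left' pos)
  then have "norm (ip (x + y) (Q (x + y))) \<le> norm (2 *\<^sub>R ip x (Q x) + 2 *\<^sub>R ip y (Q y))"
    by (intro norm_mono_cle pos)
  also have "\<dots> \<le> 2 * norm (ip x (Q x)) + 2 * norm (ip y (Q y))"
    by (rule norm_triangle_le) simp
  finally show ?thesis .
qed

lemma pos_operator_norm_ract_le:
  assumes "pos_operator Q"
  shows "norm (ip (ract x a) (Q (ract x a))) \<le> (norm a)\<^sup>2 * norm (ip x (Q x))"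
proof -
  have sym: "ip x (Q y) = ip (Q x) y" for x y
    using assms by (auto simp: pos_operator_def)
  have "ip (ract x a) (Q (ract x a)) = (st a * ip x (Q x)) * a"
    unfolding sym[of "ract x a"] by (simp add: ip_ract_right sym[symmetric] ip_ract_left)
  also have "norm \<dots> \<le> norm (st a * ip x (Q x)) * norm a" by (rule norm_mult_ineq)
  also have "\<dots> \<le> norm (st a) * norm (ip x (Q x)) * norm a"
    by (intro mult_right_mono norm_mult_ineq norm_ge_zero)
  finally show ?thesis by (simp add: power2_eq_square algebra_simps)
qed

lemma exists_parseval_frame:
  assumes "countably_generated ract"
  obtains X where "admissible st ip UNIV X"
    "\<And>x. (\<lambda>i. ip x (X i) * ip (X i) x) sums ip x x"
proof -
  obtain g :: "nat \<Rightarrow> 'm" where g: "closure {(\<Sum>i<n. ract (g i) (c i)) | n c. True} = UNIV"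
    using assms unfolding countably_generated_def by blast
  define good where "good Q g v \<longleftrightarrow> pos_operator (\<lambda>y. Q y - ract v (ip v y)) \<and>
      norm (ip g (Q g - ract v (ip v g))) \<le> norm (ip g (Q g)) / 2" for Q g v
  define V where "V Q g = (SOME v. good Q g v)" for Q g
  have V: "good Q g (V Q g)" if "pos_operator Q" for Q g
  proof -
    have "\<exists>v. good Q g v" unfolding good_def by (rule frame_step[OF that]) blast
    then show ?thesis unfolding V_def by (rule someI_ex)
  qed
  \<comment> \<open>Through the pairing function every generator occurs as \<open>\<pi> n\<close>
    for arbitrarily large \<open>n\<close>.\<close>
  define \<pi> where "\<pi> n = g (fst (prod_decode n))" for n
  define Q where "Q = rec_nat (\<lambda>y. y) (\<lambda>n Q y. Q y - ract (V Q (\<pi> n)) (ip (V Q (\<pi> n)) y))"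
  define X where "X n = V (Q n) (\<pi> n)" for n
  have Q0: "Q 0 = (\<lambda>y. y)" and QS: "Q (Suc n) = (\<lambda>y. Q n y - ract (X n) (ip (X n) y))" for n
    by (simp_all add: Q_def X_def)
  have Qpos: "pos_operator (Q n)" for n
  proof (induction n)
    case 0
    show ?case by (simp add: Q0 pos_operator_def cpos_ip)
  next
    case (Suc n)
    then show ?case using V[of "Q n" "\<pi> n"] by (simp add: QS X_def good_def)
  qed
  define N where "N n x = norm (ip x (Q n x))" for n x
  have half: "N (Suc n) (\<pi> n) \<le> N n (\<pi> n) / 2" for n
    using V[OF Qpos, of n "\<pi> n"] by (simp add: N_def QS X_def good_def)
  have step: "ip x (Q n x) - ip x (Q (Suc n) x) = ip x (X n) * ip (X n) x" for n x
    by (simp add: QS ip_diff_right ip_ract_right)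
  \<comment> \<open>Parseval's identity up to the remainder \<open>ip x (Q n x)\<close>, which is
    shown below to tend to 0.\<close>
  have Qsum: "ip x (Q n x) = ip x x - (\<Sum>i<n. ip x (X i) * ip (X i) x)" for n x
    by (induction n) (simp_all add: Q0 step[symmetric])
  have Qcpos: "cpos st (ip x (Q n x))" for n x
    using Qpos[of n] unfolding pos_operator_def by blast
  have decr: "N (Suc n) x \<le> N n x" for n x
    unfolding N_def by (intro norm_mono_cle Qcpos) (simp add: cle_def step cpos_ip_mult_ip)
  then have dec: "N m x \<le> N n x" if "n \<le> m" for n m x
    using that by (rule lift_Suc_antimono_le)
  have N0: "N n x \<le> (norm x)\<^sup>2" for n x
    using dec[of 0 n x] by (simp add: N_def[of 0] Q0 norm_ip_self)
  have gen: "(\<lambda>n. N n (g i)) \<longlonglongrightarrow> 0" for i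
  proof -
    have "decseq (\<lambda>n. N n (g i))" using decr by (rule decseq_SucI)
    moreover have "0 \<le> N n (g i)" for n by (simp add: N_def)
    ultimately obtain L where L: "(\<lambda>n. N n (g i)) \<longlonglongrightarrow> L" "\<And>n. L \<le> N n (g i)"
      using decseq_convergent[of "\<lambda>n. N n (g i)" 0] by metis
    have "L \<le> 0"
    proof (rule ccontr)
      assume "\<not> L \<le> 0"
      \<comment> \<open>Once \<open>N n (g i) < 2 * L\<close>, the next halving at
        \<open>g i\<close> would fall below the limit of a decreasing sequence.\<close>
      then have "L < 2 * L" by simp
      then obtain n0 where n0: "\<And>n. n0 \<le> n \<Longrightarrow> N n (g i) < 2 * L"
        using order_tendstoD(2)[OF L(1)] unfolding eventually_sequentially by blast
      define n where "n = prod_encode (i, n0)"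
      have "N (Suc n) (g i) \<le> N n (g i) / 2" using half[of n] by (simp add: n_def \<pi>_def)
      moreover have "n0 \<le> n" unfolding n_def by (rule le_prod_encode_2)
      ultimately show False using n0[of n] L(2)[of "Suc n"] by simp
    qed
    moreover have "0 \<le> L" using L(1) by (rule LIMSEQ_le_const) (simp add: N_def)
    ultimately show ?thesis using L(1) by simp
  qed
  have nonneg: "0 \<le> N n x" for n x by (simp add: N_def)
  have lin: "(\<lambda>n. N n (\<Sum>i<k. ract (g i) (c i))) \<longlonglongrightarrow> 0" for k c
  proof (induction k)
    case 0
    show ?case by (simp add: N_def)
  next
    case (Suc k)
    let ?y = "\<Sum>i<k. ract (g i) (c i)"
    have le: "N n (?y + ract (g k) (c k)) \<le> 2 * N n ?y + 2 * ((norm (c k))\<^sup>2 * N n (g k))" for n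
      using pos_operator_norm_add_le[OF Qpos, of ?y "ract (g k) (c k)" n]
        pos_operator_norm_ract_le[OF Qpos, of "g k" "c k" n] by (simp add: N_def)
    have "(\<lambda>n. 2 * N n ?y + 2 * ((norm (c k))\<^sup>2 * N n (g k))) \<longlonglongrightarrow> 2 * 0 + 2 * ((norm (c k))\<^sup>2 * 0)"
      by (intro tendsto_intros Suc gen)
    then have "(\<lambda>n. 2 * N n ?y + 2 * ((norm (c k))\<^sup>2 * N n (g k))) \<longlonglongrightarrow> 0" by simp
    then have "(\<lambda>n. N n (?y + ract (g k) (c k))) \<longlonglongrightarrow> 0"
      by (rule tendsto_sandwich[OF _ _ tendsto_const, rotated -1]) (auto simp: nonneg le)
    then show ?case by simp
  qed
  \<comment> \<open>The bound \<open>N0\<close>, uniform in \<open>n\<close>, carries convergence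
    from the dense set of combinations to every \<open>x\<close>.\<close>
  have all: "(\<lambda>n. ip x (Q n x)) \<longlonglongrightarrow> 0" for x
  proof (rule LIMSEQ_I)
    fix \<epsilon> :: real assume \<epsilon>: "0 < \<epsilon>"
    have "x \<in> closure {(\<Sum>i<n. ract (g i) (c i)) | n c. True}" unfolding g by (rule UNIV_I)
    then obtain k c where kc: "dist (\<Sum>i<k. ract (g i) (c i)) x < sqrt (\<epsilon> / 4)"
      unfolding closure_approachable using \<epsilon>
      by (elim allE[of _ "sqrt (\<epsilon> / 4)"] impE) auto
    define y where "y = (\<Sum>i<k. ract (g i) (c i))"
    have "(norm (x - y))\<^sup>2 < (sqrt (\<epsilon> / 4))\<^sup>2"
      using kc by (intro power_strict_mono) (auto simp: y_def dist_norm norm_minus_commute)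
    then have d: "(norm (x - y))\<^sup>2 < \<epsilon> / 4" using \<epsilon> by simp
    obtain n0 where n0: "\<And>n. n0 \<le> n \<Longrightarrow> N n y < \<epsilon> / 4"
      using order_tendstoD(2)[OF lin[of c k], of "\<epsilon> / 4"] \<epsilon>
      unfolding eventually_sequentially y_def by auto
    have "norm (ip x (Q n x) - 0) < \<epsilon>" if "n0 \<le> n" for n
      using pos_operator_norm_add_le[OF Qpos, of "x - y" y n] N0[of n "x - y"] n0[OF that] d
      by (simp add: N_def)
    then show "\<exists>n0. \<forall>n\<ge>n0. norm (ip x (Q n x) - 0) < \<epsilon>" by blast
  qed
  have sums: "(\<lambda>i. ip x (X i) * ip (X i) x) sums ip x x" for x
  proof -
    have "(\<lambda>n. ip x x - ip x (Q n x)) \<longlonglongrightarrow> ip x x - 0" by (intro tendsto_intros all)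
    then show ?thesis by (simp add: sums_def Qsum)
  qed
  show thesis
  proof
    have "cle st (\<Sum>i<n. ip x (X i) * ip (X i) x) (ip x x)" for n x
      using Qcpos[of x n] by (simp add: cle_def Qsum)
    then show "admissible st ip UNIV X"
      unfolding admissible_def using sums sums_summable by blast
  qed fact
qed

text \<open>For the block operator \<open>D\<close> with \<open>w = D x\<close> and
  \<open>0 \<le> D \<le> 1\<close> this is \<open>D^2 \<le> D\<close>. In forms,
  \<open>S x - ip w w = S (x - w) + (ip w w - S w)\<close>, and admissibility makes the last bracket
  positive.\<close>

lemma synthesis_block_cle:
  fixes n m :: nat and x :: "'m"
  assumes X: "admissible st ip UNIV X"
  defines "w \<equiv> \<Sum>i=n..<m. ract (X i) (ip (X i) x)"
  shows "cle st (ip w w) (\<Sum>i=n..<m. ip x (X i) * ip (X i) x)"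
proof -
  define S where "S y = (\<Sum>i=n..<m. ip y (X i) * ip (X i) y)" for y
  have ipd: "ip y w = (\<Sum>i=n..<m. ip y (X i) * ip (X i) x)"
    and dip: "ip w y = (\<Sum>i=n..<m. ip x (X i) * ip (X i) y)" for y
    by (simp_all add: w_def ip_sum_right ip_sum_left ip_ract_right ip_ract_left st_ip)
  have "S (x - w) = S x - ip w w - ip w w + S w"
    by (subst (1) dip, subst ipd)
       (simp add: S_def ip_diff_left ip_diff_right left_diff_distrib right_diff_distrib
        sum_subtractf)
  then have "S x - ip w w = S (x - w) + (ip w w - S w)"
    by (simp add: algebra_simps)
  moreover have "cpos st (S (x - w))" unfolding S_def by (intro cpos_sum cpos_ip_mult_ip)
  moreover have "cpos st (ip w w - S w)"
    using admissible_block_cle[OF X] by (simp add: cle_def S_def)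
  ultimately have "cpos st (S x - ip w w)" using cpos_add by metis
  then show ?thesis by (simp add: cle_def S_def)
qed

text \<open>Since \<open>ip x (P n) = S n\<close> and \<open>ip (P n) (P n)\<close> lies below
  \<open>S n\<close>, the squared distance from \<open>P n\<close> to \<open>x\<close> is at most
  the norm of the Parseval remainder \<open>ip x x - S n\<close>.\<close>

lemma frame_reconstruction:
  assumes X: "admissible st ip UNIV X" and sums: "(\<lambda>i. ip x (X i) * ip (X i) x) sums ip x x"
  shows "(\<lambda>n. \<Sum>i<n. ract (X i) (ip (X i) x)) \<longlonglongrightarrow> x"
proof -
  define P where "P n = (\<Sum>i=0..<n. ract (X i) (ip (X i) x))" for n
  define S where "S n = (\<Sum>i=0..<n. ip x (X i) * ip (X i) x)" for n
  have xP: "ip x (P n) = S n" "ip (P n) x = S n" for n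
    by (simp_all add: P_def S_def ip_sum_right ip_sum_left ip_ract_right ip_ract_left st_ip)
  have le: "norm (x - P n) \<le> sqrt (norm (ip x x - S n))" for n
  proof -
    have "cle st (ip (P n) (P n)) (S n)"
      unfolding P_def S_def by (rule synthesis_block_cle[OF X])
    then have "cle st (ip (x - P n) (x - P n)) (ip x x - S n)"
      by (simp add: cle_def ip_diff_left ip_diff_right xP algebra_simps)
    then have "norm (ip (x - P n) (x - P n)) \<le> norm (ip x x - S n)"
      by (intro norm_mono_cle cpos_ip)
    then show ?thesis by (simp add: norm_eq_sqrt)
  qed
  have lim: "(\<lambda>n. sqrt (norm (ip x x - S n))) \<longlonglongrightarrow> 0"
  proof -
    have "S \<longlonglongrightarrow> ip x x" using sums by (simp add: sums_def S_def[abs_def] lessThan_atLeast0)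
    then have "(\<lambda>n. sqrt (norm (ip x x - S n))) \<longlonglongrightarrow> sqrt (norm (ip x x - ip x x))"
      by (intro tendsto_intros)
    then show ?thesis by simp
  qed
  have "(\<lambda>n. x - P n) \<longlonglongrightarrow> 0"
    by (rule Lim_null_comparison[OF _ lim]) (simp add: le)
  then have "(\<lambda>n. x - (x - P n)) \<longlonglongrightarrow> x - 0" by (intro tendsto_intros)
  then show ?thesis by (simp add: P_def lessThan_atLeast0)
qed

end

section \<open>Totally bounded image implies compactness\<close>

context hilbert_mod
begin

text \<open>If the frame truncations did not converge uniformly on \<open>Y\<close>, there would be successive
blocks \<open>d k\<close> of the frame operator and \<open>y k \<in> Y\<close> with \<open>\<parallel>d k (y k)\<parallel> > \<epsilon>\<close>. The vectors
\<open>d k (y k) / C\<close> form an admissible system, and states norming \<open>\<langle>y k, d k (y k)\<rangle>\<close> separate \<open>y k\<close>,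
for large \<open>k\<close>, from any finite subset of \<open>Y\<close>.\<close>

lemma truncations_uniform_of_totally_bounded:
  assumes X: "admissible st ip UNIV X" and sums: "\<And>x. (\<lambda>i. ip x (X i) * ip (X i) x) sums ip x x"
    and tb: "totally_bounded_mod cm st ip UNIV Y"
    and C: "0 < C" "\<And>y. y \<in> Y \<Longrightarrow> norm y \<le> C" and \<epsilon>: "0 < \<epsilon>"
  shows "\<exists>n. \<forall>y\<in>Y. norm (y - (\<Sum>i<n. ract (X i) (ip (X i) y))) \<le> \<epsilon>"
proof (rule ccontr)
  assume "\<not> ?thesis"
  then have ex: "\<exists>y\<in>Y. \<epsilon> < norm (y - (\<Sum>i<n. ract (X i) (ip (X i) y)))" for n
    by (auto simp: not_le)
  \<comment> \<open>Reconstruction lets the upper end tend to infinity, so the failure at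
    \<open>n\<close> is already visible in a finite block starting at \<open>n\<close>.\<close>
  have "\<exists>y m. n < m \<and> y \<in> Y \<and> \<epsilon> < norm (\<Sum>i=n..<m. ract (X i) (ip (X i) y))" for n
  proof -
    obtain y where y: "y \<in> Y" "\<epsilon> < norm (y - (\<Sum>i<n. ract (X i) (ip (X i) y)))" using ex by blast
    let ?P = "\<lambda>m. \<Sum>i<m. ract (X i) (ip (X i) y)"
    have "(\<lambda>m. norm (?P m - ?P n)) \<longlonglongrightarrow> norm (y - ?P n)"
      by (intro tendsto_intros frame_reconstruction X sums)
    then have "\<forall>\<^sub>F m in sequentially. \<epsilon> < norm (?P m - ?P n)" using y(2) by (rule order_tendstoD(1))
    moreover have "\<forall>\<^sub>F m in sequentially. n < m" by (rule eventually_gt_at_top)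
    ultimately have "\<forall>\<^sub>F m in sequentially. \<epsilon> < norm (?P m - ?P n) \<and> n < m" by (rule eventually_conj)
    then obtain m where m: "\<epsilon> < norm (?P m - ?P n)" "n < m"
      unfolding eventually_sequentially by blast
    have "?P m - ?P n = (\<Sum>i=n..<m. ract (X i) (ip (X i) y))"
      using m(2) sum_diff_nat_ivl[of 0 n m "\<lambda>i. ract (X i) (ip (X i) y)"] by (simp add: lessThan_atLeast0)
    then show ?thesis using m y(1) by auto
  qed
  then obtain y' m' where ym: "\<And>n. n < m' n" "\<And>n. y' n \<in> Y"
    "\<And>n. \<epsilon> < norm (\<Sum>i=n..<m' n. ract (X i) (ip (X i) (y' n)))" by metis
  \<comment> \<open>Each block starts where the preceding one ends, so sums of consecutive blocks
    are again blocks of \<open>X\<close>.\<close>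
  define b where "b k = (m' ^^ k) 0" for k
  have bS: "b (Suc k) = m' (b k)" for k by (simp add: b_def)
  have b_less: "b k < b (Suc k)" for k by (simp add: bS ym(1))
  have b_mono: "b k \<le> b l" if "k \<le> l" for k l
    by (rule lift_Suc_mono_le[of b, OF less_imp_le[OF b_less] that])
  define y where "y k = y' (b k)" for k
  define d where "d k x = (\<Sum>i=b k..<b (Suc k). ract (X i) (ip (X i) x))" for k x
  define S where "S k x = (\<Sum>i=b k..<b (Suc k). ip x (X i) * ip (X i) x)" for k x
  define Z where "Z k = (1 / C) *\<^sub>R d k (y k)" for k
  have yY: "y k \<in> Y" and dy: "\<epsilon> < norm (d k (y k))" for k
    using ym(2,3) by (simp_all add: y_def d_def bS)
  have d_sym: "ip x (d k w) = ip (d k x) w" for k x w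
    by (simp add: d_def ip_sum_right ip_sum_left ip_ract_right ip_ract_left st_ip)
  have dS: "cle st (ip (d k x) (d k x)) (S k x)" for k x
    unfolding d_def S_def by (rule synthesis_block_cle[OF X])
  \<comment> \<open>By symmetry of \<open>d k\<close>, \<open>ip x (Z k) = ip (d k x) v\<close> with
    \<open>norm v \<le> 1\<close>; then Cauchy-Schwarz and \<open>dS\<close> apply.\<close>
  have ZS: "cle st (ip x (Z k) * ip (Z k) x) (S k x)" for k x
  proof -
    define v where "v = (1 / C) *\<^sub>R y k"
    have v: "norm v \<le> 1" using C(1) C(2)[OF yY[of k]] by (simp add: v_def)
    have "ip x (Z k) = ip (d k x) v"
      by (simp add: Z_def v_def ip_scaleR_right d_sym)
    moreover from this have "ip (Z k) x = ip v (d k x)" by (metis st_ip)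
    ultimately have "cle st (ip x (Z k) * ip (Z k) x) ((norm v)\<^sup>2 *\<^sub>R ip (d k x) (d k x))"
      using cauchy_schwarz_cle[of "d k x" v] by simp
    moreover have "cle st ((norm v)\<^sup>2 *\<^sub>R ip (d k x) (d k x)) (ip (d k x) (d k x))"
      using cpos_scaleR[OF cpos_ip, of "1 - (norm v)\<^sup>2" "d k x"] v
      by (simp add: cle_def algebra_simps power_le_one)
    ultimately show ?thesis using dS cle_trans by blast
  qed
  have Ssum: "(\<Sum>k=p..<q. S k x) = (\<Sum>i=b p..<b q. ip x (X i) * ip (X i) x)" if "p \<le> q" for p q x
    using that
  proof (induction q rule: dec_induct)
    case (step q)
    then show ?case
      using sum.atLeastLessThan_concat[of "b p" "b q" "b (Suc q)" "\<lambda>i. ip x (X i) * ip (X i) x"]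
        b_mono[of p q] b_less[of q] by (simp add: S_def)
  qed simp
  have ZSsum: "cle st (\<Sum>k=p..<q. ip x (Z k) * ip (Z k) x) (\<Sum>i=b p..<b q. ip x (X i) * ip (X i) x)"
    if "p \<le> q" for p q x
    using cle_sum_mono[of "{p..<q}" "\<lambda>k. ip x (Z k) * ip (Z k) x" "\<lambda>k. S k x"] ZS Ssum[OF that] by simp
  have Zadm: "admissible st ip UNIV Z"
    unfolding admissible_def
  proof (intro ballI conjI allI)
    fix x n
    show "cle st (\<Sum>k<n. ip x (Z k) * ip (Z k) x) (ip x x)"
      using cle_trans[OF ZSsum[of 0 n x] admissible_block_cle[OF X]] by (simp add: lessThan_atLeast0)
  next
    fix x
    show "summable (\<lambda>k. ip x (Z k) * ip (Z k) x)"
      unfolding summable_Cauchy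
    proof (intro allI impI)
      fix \<delta> :: real assume "0 < \<delta>"
      then obtain K where K: "\<And>n m. K \<le> n \<Longrightarrow> norm (\<Sum>i=n..<m. ip x (X i) * ip (X i) x) < \<delta>"
        using sums_summable[OF sums[of x]] unfolding summable_Cauchy by blast
      have bK: "k \<le> b k" for k
        by (induction k) (simp_all add: Suc_le_eq le_less_trans[OF _ b_less])
      show "\<exists>K. \<forall>p\<ge>K. \<forall>q. norm (\<Sum>k=p..<q. ip x (Z k) * ip (Z k) x) < \<delta>"
      proof (intro exI[of _ K] allI impI)
        fix p q assume p: "K \<le> p"
        show "norm (\<Sum>k=p..<q. ip x (Z k) * ip (Z k) x) < \<delta>"
        proof (cases "p \<le> q")
          case True
          have "norm (\<Sum>k=p..<q. ip x (Z k) * ip (Z k) x)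
              \<le> norm (\<Sum>i=b p..<b q. ip x (X i) * ip (X i) x)"
            by (intro norm_mono_cle cpos_sum cpos_ip_mult_ip ZSsum True)
          also have "\<dots> < \<delta>" using p bK[of p] by (intro K) simp
          finally show ?thesis .
        qed (use \<open>0 < \<delta>\<close> in simp)
      qed
    qed
  qed
  have Spos: "cpos st (S k x)" for k x unfolding S_def by (intro cpos_sum cpos_ip_mult_ip)
  have Sy: "\<epsilon>\<^sup>2 < norm (S k (y k))" for k
  proof -
    have "\<epsilon>\<^sup>2 < (norm (d k (y k)))\<^sup>2" using dy[of k] \<epsilon> by (intro power_strict_mono) auto
    also have "\<dots> \<le> norm (S k (y k))"
      using norm_mono_cle[OF cpos_ip dS, of k "y k"] by (simp add: norm_ip_self)
    finally show ?thesis .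
  qed
  have "\<exists>\<phi>. is_state cm st \<phi> \<and> \<phi> (S k (y k)) = complex_of_real (norm (S k (y k)))" for k
  proof -
    have "S k (y k) \<noteq> 0" using Sy[of k] zero_le_power2[of \<epsilon>] by auto
    from exists_norming_state[OF Spos this] show ?thesis by metis
  qed
  then obtain \<Phi> where \<Phi>: "\<And>k. is_state cm st (\<Phi> k)"
    "\<And>k. \<Phi> k (S k (y k)) = complex_of_real (norm (S k (y k)))" by metis
  \<comment> \<open>Half of the lower bound \<open>\<epsilon>^2 / C\<close> for the modulus of
    \<open>\<Phi> k (ip (y k) (Z k))\<close>.\<close>
  define \<eta> where "\<eta> = \<epsilon>\<^sup>2 / (2 * C)"
  have \<eta>: "0 < \<eta>" using \<epsilon> C(1) by (simp add: \<eta>_def)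
  have large: "2 * \<eta> < cmod (\<Phi> k (ip (y k) (Z k)))" for k
  proof -
    have "ip (y k) (Z k) = cm (complex_of_real (1 / C)) (S k (y k))"
      unfolding cm_of_real
      by (simp add: Z_def ip_scaleR_right d_def S_def ip_sum_right ip_ract_right)
    then have "\<Phi> k (ip (y k) (Z k)) = complex_of_real (1 / C) * complex_of_real (norm (S k (y k)))"
      using \<Phi>(1)[of k] \<Phi>(2)[of k] by (simp add: is_state_def)
    then have "cmod (\<Phi> k (ip (y k) (Z k))) = norm (S k (y k)) / C"
      using C(1) by (simp add: norm_mult norm_divide)
    then show ?thesis using Sy[of k] C(1) by (simp add: \<eta>_def divide_strict_right_mono)
  qed
  obtain T where T: "finite T" "T \<subseteq> Y" "\<And>y. y \<in> Y \<Longrightarrow> \<exists>s\<in>T. dXPhi_sq ip Z \<Phi> s y < ennreal (\<eta>\<^sup>2)"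
    using tb Zadm \<Phi>(1) \<eta> unfolding totally_bounded_mod_def by meson
  \<comment> \<open>For fixed \<open>s\<close> the terms of the admissible series tend to 0, so for
    large \<open>k\<close> every point of the finite net is almost orthogonal to
    \<open>Z k\<close>.\<close>
  have "\<forall>\<^sub>F k in sequentially. norm (ip s (Z k)) < \<eta>" for s
  proof -
    have "(\<lambda>k. ip s (Z k) * ip (Z k) s) \<longlonglongrightarrow> 0"
      using Zadm by (intro summable_LIMSEQ_zero) (simp add: admissible_def)
    then have "(\<lambda>k. norm (ip s (Z k) * ip (Z k) s)) \<longlonglongrightarrow> 0" by (rule tendsto_norm_zero)
    then have "\<forall>\<^sub>F k in sequentially. norm (ip s (Z k) * ip (Z k) s) < \<eta>\<^sup>2"
      using \<eta> by (intro order_tendstoD(2)) auto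
    then show ?thesis
      using \<eta> by (auto simp: norm_ip_mult_ip elim!: eventually_mono dest: power2_less_imp_less)
  qed
  then have "\<forall>\<^sub>F k in sequentially. \<forall>s\<in>T. norm (ip s (Z k)) < \<eta>"
    using T(1) by (simp add: eventually_ball_finite)
  then obtain k where k: "\<And>s. s \<in> T \<Longrightarrow> norm (ip s (Z k)) < \<eta>"
    unfolding eventually_sequentially by blast
  obtain s where s: "s \<in> T" "dXPhi_sq ip Z \<Phi> s (y k) < ennreal (\<eta>\<^sup>2)" using T(3)[OF yY] by blast
  \<comment> \<open>In the pseudo-metric the \<open>k\<close>-th state is tested on the vectors from
    index \<open>k\<close> on, so \<open>Z k\<close> is the term \<open>j = 0\<close>.\<close>
  define t where "t j = ennreal ((cmod (\<Phi> k (ip (s - y k) (Z (k + j)))))\<^sup>2)" for j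
  have "sum t {0} \<le> suminf t" by (rule sum_le_suminf[OF summableI]) auto
  also have "suminf t \<le> dXPhi_sq ip Z \<Phi> s (y k)"
    unfolding dXPhi_sq_def t_def by (rule SUP_upper) simp
  also note s(2)
  finally have "ennreal ((cmod (\<Phi> k (ip (s - y k) (Z k))))\<^sup>2) < ennreal (\<eta>\<^sup>2)" by (simp add: t_def)
  then have "(cmod (\<Phi> k (ip (s - y k) (Z k))))\<^sup>2 < \<eta>\<^sup>2" by (simp add: ennreal_less_iff)
  then have near: "cmod (\<Phi> k (ip (s - y k) (Z k))) < \<eta>" 
    by (rule power2_less_imp_less) (use \<eta> in simp)
  have "\<Phi> k (ip s (Z k)) = \<Phi> k (ip (s - y k) (Z k)) + \<Phi> k (ip (y k) (Z k))"
    using \<Phi>(1)[of k] unfolding is_state_def by (metis diff_add_cancel ip_add_left)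
  then have "cmod (\<Phi> k (ip (y k) (Z k))) \<le> cmod (\<Phi> k (ip s (Z k))) + cmod (\<Phi> k (ip (s - y k) (Z k)))"
    by (metis add_diff_cancel_left' norm_triangle_ineq4)
  moreover have "cmod (\<Phi> k (ip s (Z k))) \<le> norm (ip s (Z k))"
    using \<Phi>(1)[of k] by (simp add: is_state_def)
  ultimately show False using near large[of k] k[OF s(1)] by linarith
qed

end

section \<open>The equivalence for adjointable operators\<close>

theorem theorem2p5:
  fixes cm :: "complex \<Rightarrow> 'a::{real_normed_algebra,banach} \<Rightarrow> 'a"
    and st :: "'a \<Rightarrow> 'a"
    and mcmM :: "complex \<Rightarrow> 'm::banach \<Rightarrow> 'm" and ractM :: "'m \<Rightarrow> 'a \<Rightarrow> 'm" and ipM :: "'m \<Rightarrow> 'm \<Rightarrow> 'a"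
    and mcmN :: "complex \<Rightarrow> 'n::banach \<Rightarrow> 'n" and ractN :: "'n \<Rightarrow> 'a \<Rightarrow> 'n" and ipN :: "'n \<Rightarrow> 'n \<Rightarrow> 'a"
    and F :: "'m \<Rightarrow> 'n"
  assumes "cstar_algebra cm st"
    and "hilbert_module cm st mcmM ractM ipM"
    and "hilbert_module cm st mcmN ractN ipN"
    and "countably_generated ractN"
    and "is_operator mcmM ractM mcmN ractN F"
    and "adjointable ipM ipN F"
  shows "A_compact mcmN ractN ipM F \<longleftrightarrow>
         totally_bounded_mod cm st ipN UNIV (F ` {x. norm x \<le> 1})"
proof -
  interpret M: hilbert_mod cm st mcmM ractM ipM by unfold_locales fact+
  interpret N: hilbert_mod cm st mcmN ractN ipN by unfold_locales fact+
  define B where "B = {x::'m. norm x \<le> 1}"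
  obtain K0 where K0: "\<And>x. norm (F x) \<le> K0 * norm x" using assms(5) unfolding is_operator_def by blast
  define C where "C = \<bar>K0\<bar> + 1"
  have C: "0 < C" by (simp add: C_def)
  have CB: "norm (F x) \<le> C" if "x \<in> B" for x
  proof -
    have "K0 * norm x \<le> \<bar>K0\<bar> * 1" using that by (intro mult_mono) (auto simp: B_def)
    then show ?thesis using K0[of x] by (simp add: C_def)
  qed
  have Fscale: "F (r *\<^sub>R x) = r *\<^sub>R F x" for r x
    using assms(5) M.mcm_of_real N.mcm_of_real unfolding is_operator_def by metis
  show ?thesis unfolding B_def[symmetric]
  proof
    assume comp: "A_compact mcmN ractN ipM F"
    show "totally_bounded_mod cm st ipN UNIV (F ` B)"
      unfolding totally_bounded_mod_def
    proof (intro conjI subset_UNIV allI impI)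
      fix X and \<Phi> :: "nat \<Rightarrow> 'a \<Rightarrow> complex" and \<epsilon> :: real
      assume X: "admissible st ipN UNIV X" and \<Phi>: "\<forall>k. is_state cm st (\<Phi> k)" and \<epsilon>: "0 < \<epsilon>"
      have "N.uniform_tails X B F"
      proof (rule N.uniform_tails_approx[OF X])
        fix \<delta> :: real assume "0 < \<delta>"
        from comp[unfolded A_compact_def, rule_format, OF this] obtain n :: nat and c x y where
          app: "\<forall>z. norm (F z - (\<Sum>i<n. mcmN (c i) (theta ractN ipM (x i) (y i) z))) \<le> \<delta> * norm z"
          by blast
        \<comment> \<open>The scalars are absorbed into algebra coefficients that are bounded on
          \<open>B\<close>, the form needed for uniform tails.\<close>
        define H where "H z = (\<Sum>i<n. ractN (x i) (cm (c i) (ipM (y i) z)))" for z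
        have "N.uniform_tails X B H"
          unfolding H_def
        proof (intro N.uniform_tails_sum N.uniform_tails_ract[OF X])
          fix i z assume "z \<in> B"
          then have "norm (ipM (y i) z) \<le> norm (y i) * 1"
            using M.norm_ip_le[of "y i" z] mult_left_mono[of "norm z" 1 "norm (y i)"] by (simp add: B_def)
          then show "norm (cm (c i) (ipM (y i) z)) \<le> cmod (c i) * norm (y i)"
            by (simp add: M.norm_cm mult_left_mono)
        qed
        moreover have "norm (F z - H z) \<le> \<delta>" if "z \<in> B" for z
        proof -
          have "norm (F z - H z) \<le> \<delta> * norm z"
            using app by (simp add: H_def theta_def N.ract_cm)
          also have "\<dots> \<le> \<delta> * 1" using that \<open>0 < \<delta>\<close> by (intro mult_left_mono) (auto simp: B_def)
          finally show ?thesis by simp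
        qed
        ultimately show "\<exists>H. N.uniform_tails X B H \<and> (\<forall>z\<in>B. norm (F z - H z) \<le> \<delta>)" by blast
      qed
      then show "\<exists>S. finite S \<and> S \<subseteq> F ` B \<and>
          (\<forall>y\<in>F ` B. \<exists>s\<in>S. dXPhi_sq ipN X \<Phi> s y < ennreal (\<epsilon>\<^sup>2))"
        using CB \<Phi> \<epsilon> by (intro N.finite_net_of_uniform_tails) auto
    qed
  next
    assume tb: "totally_bounded_mod cm st ipN UNIV (F ` B)"
    obtain X where X: "admissible st ipN UNIV X" "\<And>x. (\<lambda>i. ipN x (X i) * ipN (X i) x) sums ipN x x"
      by (rule N.exists_parseval_frame[OF assms(4)]) (rule that)
    obtain G where G: "\<And>x y. ipN (F x) y = ipM x (G y)"
      using assms(6) unfolding adjointable_def by blast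
    \<comment> \<open>The adjoint turns the frame truncation of \<open>F z\<close> into a sum of
      \<open>theta\<close> maps for the pairs \<open>X i\<close>, \<open>G (X i)\<close>.\<close>
    have G': "ipN y (F x) = ipM (G y) x" for x y by (metis G M.st_ip N.st_ip)
    show "A_compact mcmN ractN ipM F"
      unfolding A_compact_def
    proof (intro allI impI)
      fix \<epsilon> :: real assume \<epsilon>: "0 < \<epsilon>"
      have "norm y \<le> C" if "y \<in> F ` B" for y using that CB by blast
      then obtain n where n: "\<And>y. y \<in> F ` B \<Longrightarrow> norm (y - (\<Sum>i<n. ractN (X i) (ipN (X i) y))) \<le> \<epsilon>"
        using N.truncations_uniform_of_totally_bounded[OF X tb C _ \<epsilon>] by blast
      have "norm (F z - (\<Sum>i<n. ractN (X i) (ipN (X i) (F z)))) \<le> \<epsilon> * norm z" for z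
      proof (cases "z = 0")
        case True
        then show ?thesis using Fscale[of 0 0] N.ract_scaleR[of _ 0 0] by simp
      next
        case False
        define u where "u = (1 / norm z) *\<^sub>R z"
        have zu: "F z = norm z *\<^sub>R F u" using False by (simp add: u_def Fscale)
        have "u \<in> B" using False by (simp add: B_def u_def)
        then have "norm (F u - (\<Sum>i<n. ractN (X i) (ipN (X i) (F u)))) \<le> \<epsilon>" by (intro n) simp
        then have "norm z * norm (F u - (\<Sum>i<n. ractN (X i) (ipN (X i) (F u)))) \<le> norm z * \<epsilon>"
          by (intro mult_left_mono) auto
        moreover have "F z - (\<Sum>i<n. ractN (X i) (ipN (X i) (F z)))
            = norm z *\<^sub>R (F u - (\<Sum>i<n. ractN (X i) (ipN (X i) (F u))))"
          by (simp add: zu N.ip_scaleR_right N.ract_scaleR scaleR_diff_right scaleR_sum_right)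
        ultimately show ?thesis by (simp add: mult.commute)
      qed
      then have "\<forall>z. norm (F z - (\<Sum>i<n. mcmN 1 (theta ractN ipM (X i) (G (X i)) z))) \<le> \<epsilon> * norm z"
        by (simp add: theta_def G')
      then show "\<exists>n (c :: nat \<Rightarrow> complex) x y.
          \<forall>z. norm (F z - (\<Sum>i<n. mcmN (c i) (theta ractN ipM (x i) (y i) z))) \<le> \<epsilon> * norm z"
        by (intro exI[of _ n] exI[of _ "\<lambda>_. 1"] exI[of _ X] exI[of _ "\<lambda>i. G (X i)"])
    qed
  qed
qed

end
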